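(* Let $\nu_1,\nu_2,\dots$ be a family of log-concave probability measures on $\mathbb{Z}_+$. Let $\mathsf{X}=(X_1,X_2,\dots)$ be independent random variables with $X_i$ distributed according to $\nu_i$, and write $S_n=X_1+\dots+X_n$. Choose $\lambda^*\in(0,\lambda^{\max})$, let $R^*_n=E(S^{\lambda^*}_n)$ and $t^*=\log\lambda^*$, and assume that for every $\varepsilon\in(0,\log(\lambda^{\max})-t^* )$, $$M_n(t^*-\varepsilon)-M_n(t^* )+\varepsilon M_n'(t^* )\to+\infty\quad\text{and}\quad M_n(t^*+\varepsilon)-M_n(t^* )-\varepsilon M_n'(t^* )\to+\infty\qquad(n\to\infty).$$ Then the following limits hold as $n\to\infty$, in the sense of convergence of finite-dimensional distributions: (i) if $1<\lambda^*<\lambda^{\max}$, then $P(\mathsf{X}\in\cdot\mid S_n>R^*_n)\to P(\mathsf{X}^{\lambda^*}\in\cdot)$; (ii) if $0<\lambda^*<1$, then $P(\mathsf{X}\in\cdot\mid S_n<R^*_n)\to P(\mathsf{X}^{\lambda^*}\in\cdot)$; (iii) if $0<\lambda^*<\lambda^{\max}$, then $P(\mathsf{X}\in\cdot\mid S_n=\lfloor R^*_n\rfloor)\to P(\mathsf{X}^{\lambda^*}\in\cdot)$.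
   Context: $\mathbb{Z}_+=\{0,1,2,\dots\}$. For a sequence of probability measures $\nu_1,\nu_2,\dots$ on $\mathbb{Z}_+$ and $\lambda>0$, let $Z^\lambda_i:=\sum_{z}\lambda^z\nu_i(z)$ and $\lambda^{\max}:=\sup\{\lambda>0: Z^\lambda_i<\infty\text{ for all }i\}\in(0,\infty]$ (with $\log\infty=\infty$). For $\lambda\in(0,\lambda^{\max})$ the tilted measures are $\nu^\lambda_i(x):=\lambda^x\nu_i(x)/Z^\lambda_i$, and $\mathsf{X}^\lambda=(X^\lambda_1,X^\lambda_2,\dots)$ is a sequence of independent random variables with $X_i^\lambda$ distributed according to $\nu_i^\lambda$; $S^\lambda_n:=X^\lambda_1+\dots+X^\lambda_n$. Thus $\nu_i^1=\nu_i$. $M_n(t):=\sum_{i=1}^n\log\bigl(Z_i^{e^t}\bigr)=\sum_{i=1}^n\log E(e^{tX_i})$ for $t<\log\lambda^{\max}$, and $M_n'$ is its derivative. Let $\max_i:=\sup\{x\in\mathbb{Z}_+:\nu_i(x)>0\}$ (possibly infinite). The measure $\nu_i$ is log-concave if $\nu_i(x)>0$ for all integers $x$ with $0\le x\le\max_i$ and $\frac{\nu_i(x-1)}{\nu_i(x)}\le\frac{\nu_i(x)}{\nu_i(x+1)}$ for all integers $0<x<\max_i$. Convergence of finite-dimensional distributions means: for each $\ell\ge1$, the (conditional) laws of the first $\ell$ coordinates converge weakly on $\mathbb{Z}_+^\ell$. The conditional probabilities are considered for $n$ large enough that the conditioning event has positive probability. *)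

theory Defs
  imports "HOL-Probability.Probability"
begin

definition part_fun :: "nat pmf \<Rightarrow> real \<Rightarrow> ennreal" where
  "part_fun p lam = (\<Sum>z. ennreal (lam ^ z * pmf p z))"

text \<open>A sequence \<open>\<nu>\<^sub>1, \<nu>\<^sub>2, \<dots>\<close> is indexed from 0 here, so \<open>\<nu> i\<close> stands for \<open>\<nu>\<^sub>i\<^sub>+\<^sub>1\<close>.\<close>

definition lambda_max :: "(nat \<Rightarrow> nat pmf) \<Rightarrow> ereal" where
  "lambda_max \<nu> = Sup {ereal lam | lam. lam > 0 \<and> (\<forall>i. part_fun (\<nu> i) lam < \<infinity>)}"

text \<open>Meaningful when \<open>lam > 0\<close> and \<open>part_fun p lam < \<infinity>\<close>; see \<open>pmf_tilted\<close> below.\<close>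

definition tilted :: "nat pmf \<Rightarrow> real \<Rightarrow> nat pmf" where
  "tilted p lam = embed_pmf (\<lambda>x. lam ^ x * pmf p x / enn2real (part_fun p lam))"

definition ereal_ln :: "ereal \<Rightarrow> ereal" where
  "ereal_ln x = (if x \<le> 0 then -\<infinity> else if x = \<infinity> then \<infinity> else ereal (ln (real_of_ereal x)))"

definition log_mgf_sum :: "(nat \<Rightarrow> nat pmf) \<Rightarrow> nat \<Rightarrow> real \<Rightarrow> real" where
  "log_mgf_sum \<nu> n t = (\<Sum>i<n. ln (enn2real (part_fun (\<nu> i) (exp t))))"

definition max_supp :: "nat pmf \<Rightarrow> enat" where
  "max_supp p = Sup (enat ` {x. pmf p x > 0})"

definition log_concave_pmf :: "nat pmf \<Rightarrow> bool" where
  "log_concave_pmf p \<longleftrightarrow>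
     (\<forall>x. enat x \<le> max_supp p \<longrightarrow> pmf p x > 0) \<and>
     (\<forall>x. 0 < x \<and> enat x < max_supp p \<longrightarrow>
        pmf p (x - 1) / pmf p x \<le> pmf p x / pmf p (x + 1))"

definition indep_with_laws ::
  "'a measure \<Rightarrow> (nat \<Rightarrow> 'a \<Rightarrow> nat) \<Rightarrow> (nat \<Rightarrow> nat pmf) \<Rightarrow> bool" where
  "indep_with_laws M X \<nu> \<longleftrightarrow>
     prob_space M \<and>
     prob_space.indep_vars M (\<lambda>_. count_space UNIV) X UNIV \<and>
     (\<forall>i. distr M (count_space UNIV) (X i) = measure_pmf (\<nu> i))"

definition partial_sum :: "(nat \<Rightarrow> 'a \<Rightarrow> nat) \<Rightarrow> nat \<Rightarrow> 'a \<Rightarrow> nat" where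
  "partial_sum X n \<omega> = (\<Sum>i<n. X i \<omega>)"

text \<open>Elements of \<open>\<int>\<^sub>+\<close> to the power \<open>l\<close> are represented as lists of length \<open>l\<close>.\<close>

definition fdd_law :: "'a measure \<Rightarrow> (nat \<Rightarrow> 'a \<Rightarrow> nat) \<Rightarrow> nat \<Rightarrow> nat list measure" where
  "fdd_law M X l = distr M (count_space UNIV) (\<lambda>\<omega>. map (\<lambda>i. X i \<omega>) [0..<l])"

text \<open>Weak convergence on a discrete space, where every function is continuous.\<close>

definition weak_conv_discrete :: "(nat \<Rightarrow> 'b measure) \<Rightarrow> 'b measure \<Rightarrow> bool" where
  "weak_conv_discrete \<mu>s \<mu> \<longleftrightarrow>
     (\<forall>f :: 'b \<Rightarrow> real. bounded (range f) \<longrightarrow>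
        (\<lambda>n. \<integral>x. f x \<partial>(\<mu>s n)) \<longlonglongrightarrow> (\<integral>x. f x \<partial>\<mu>))"

text \<open>
  The laws of \<open>X\<close> given the events \<open>{\<omega> \<in> space M. A n \<omega>}\<close> converge to the law of \<open>Y\<close>.
  If an event has probability 0, then \<open>uniform_measure\<close> is the null measure. Testing against
  \<open>f = 1\<close> therefore shows that convergence includes positivity of the probabilities for all large \<open>n\<close>.
\<close>

definition cond_fdd_conv ::
  "'a measure \<Rightarrow> (nat \<Rightarrow> 'a \<Rightarrow> nat) \<Rightarrow> (nat \<Rightarrow> 'a \<Rightarrow> bool) \<Rightarrow>
   'b measure \<Rightarrow> (nat \<Rightarrow> 'b \<Rightarrow> nat) \<Rightarrow> bool" where
  "cond_fdd_conv M X A N Y \<longleftrightarrow>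
     (\<forall>l\<ge>1. weak_conv_discrete
        (\<lambda>n. fdd_law (uniform_measure M {\<omega> \<in> space M. A n \<omega>}) X l)
        (fdd_law N Y l))"

lemma pmf_tilted:
  assumes "lam > 0" and "part_fun p lam < \<infinity>"
  shows "pmf (tilted p lam) x = lam ^ x * pmf p x / enn2real (part_fun p lam)"
proof -
  define Z where "Z = enn2real (part_fun p lam)"
  have Z: "part_fun p lam = ennreal Z" "Z \<ge> 0"
    using assms(2) by (simp_all add: Z_def)
  obtain y where y: "pmf p y > 0"
    using set_pmf_not_empty[of p] by (meson ex_in_conv pmf_positive)
  have "ennreal (lam ^ y * pmf p y) \<le> part_fun p lam"
    using sum_le_suminf[of "\<lambda>z. ennreal (lam ^ z * pmf p z)" "{y}"]
    by (simp add: part_fun_def)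
  moreover have "lam ^ y * pmf p y > 0"
    using y assms(1) by simp
  ultimately have "Z > 0"
    using Z by (metis ennreal_le_iff less_le_trans)
  have "(\<integral>\<^sup>+ x. ennreal (lam ^ x * pmf p x / Z) \<partial>count_space UNIV)
      = (\<Sum>z. ennreal (lam ^ z * pmf p z) / ennreal Z)"
    using \<open>Z > 0\<close> assms(1) by (simp add: nn_integral_count_space_nat divide_ennreal)
  also have "\<dots> = part_fun p lam / ennreal Z"
    by (simp add: part_fun_def divide_ennreal_def)
  also have "\<dots> = 1"
    using Z \<open>Z > 0\<close> by (simp add: divide_ennreal)
  finally show ?thesis
    using \<open>Z > 0\<close> assms(1) unfolding tilted_def Z_def
    by (subst pmf_embed_pmf) auto
qed

end

theory Submission
  imports Defs
begin

text \<open>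
  Write \<open>t = ln lam\<close>. The three conditioning events all have the form \<open>S\<^sub>n - c\<^sub>n \<in> A\<close>, where \<open>c\<^sub>n\<close> is an
  integer within distance 1 of \<open>R\<^sub>n\<close> and \<open>A\<close> is \<open>{0..}\<close>, \<open>{..0}\<close> or \<open>{0}\<close>. On lists of length \<open>n\<close> the
  law of \<open>X\<close> has density proportional to \<open>exp (- t * sum)\<close> with respect to the law of \<open>Y\<close>. Splitting
  a list into its first \<open>l\<close> entries \<open>as\<close> and the rest, whose sum has the law \<open>V\<^sub>n\<close> under \<open>Y\<close>, one gets
  that the conditional expectation of \<open>f\<close> is the quotient \<open>I\<^sub>n f / I\<^sub>n 1\<close>, where
  \<open>I\<^sub>n f\<close> is the expectation over \<open>as\<close> (drawn from the law of \<open>Y\<close>) of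
  \<open>f as * (\<Sum>j\<in>A. exp (- t * j) * V\<^sub>n (c\<^sub>n + j - sum as))\<close>.
  If \<open>V\<^sub>n (c\<^sub>n + m) / V\<^sub>n (c\<^sub>n) \<rightarrow> 1\<close> for each \<open>m\<close>, with a bound \<open>exp (e * \<bar>m\<bar>)\<close> for every \<open>e > 0\<close>, then
  dominated convergence (\<open>mixture_limit\<close>) yields
  \<open>I\<^sub>n f / V\<^sub>n (c\<^sub>n) \<rightarrow> (\<Sum>j\<in>A. exp (- t * j)) * E (f (Y\<^sub>1, \<dots>, Y\<^sub>l))\<close>, and the constant cancels in
  the quotient. The sign of \<open>t\<close> makes the sum over a half line converge.

  So everything rests on the flatness of \<open>V\<^sub>n\<close> near \<open>R\<^sub>n\<close> (\<open>slow_variation_limit\<close>), and this is where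
  log-concavity enters. Convolution preserves it (\<open>log_concave_seq_convolution\<close>, a Cauchy-Binet
  argument), so the successive ratios of \<open>V\<^sub>n\<close> are decreasing. If \<open>V\<^sub>n (c\<^sub>n + 1) / V\<^sub>n (c\<^sub>n)\<close> were at most
  \<open>exp (- 2 * e)\<close>, then \<open>V\<^sub>n\<close> would decay so fast to the right of \<open>c\<^sub>n\<close> that its exponential moment
  \<open>E (exp (e * (x - c\<^sub>n)))\<close> would be bounded by a constant depending on \<open>e\<close> alone; if
  \<open>V\<^sub>n (c\<^sub>n) / V\<^sub>n (c\<^sub>n - 1)\<close> were at least \<open>exp (2 * e)\<close>, the same would follow for \<open>- e\<close>. But
  \<open>R\<^sub>n\<close> is the derivative of the log moment generating function at \<open>t\<close>
  (\<open>expectation_partial_sum_eq_deriv\<close>), so both hypotheses on \<open>log_mgf_sum\<close> say precisely that the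
  logarithms of these centred exponential moments tend to infinity for the full sums; dropping the
  first \<open>l\<close> summands and moving the centre by at most 1 changes them by a bounded amount
  (\<open>filterlim_moments_shifted\<close>).
\<close>

section \<open>Log-concave sequences on the integers\<close>

text \<open>
  The four-point form of log-concavity is symmetric under reflection and includes the absence of
  internal zeros, so it can be used without discussing supports.
\<close>
definition log_concave_seq :: "(int \<Rightarrow> real) \<Rightarrow> bool" where
  "log_concave_seq f \<longleftrightarrow> (\<forall>m. 0 \<le> f m) \<and>
     (\<forall>a b c d. a \<le> b \<longrightarrow> a \<le> c \<longrightarrow> a + d = b + c \<longrightarrow> f a * f d \<le> f b * f c)"

lemma log_concave_seqD:
  assumes "log_concave_seq f"
  shows "0 \<le> f m"
    and "a \<le> b \<Longrightarrow> a \<le> c \<Longrightarrow> a + d = b + c \<Longrightarrow> f a * f d \<le> f b * f c"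
  using assms unfolding log_concave_seq_def by blast+

lemma log_concave_seq_reflect:
  assumes "log_concave_seq f"
  shows "log_concave_seq (\<lambda>m. f (- m))"
  unfolding log_concave_seq_def
proof (intro conjI allI impI)
  fix a b c d :: int
  assume "a \<le> b" "a \<le> c" "a + d = b + c"
  then have "f (- d) * f (- a) \<le> f (- b) * f (- c)"
    by (intro log_concave_seqD(2)[OF assms]) auto
  then show "f (- a) * f (- d) \<le> f (- b) * f (- c)"
    by (simp add: mult.commute)
qed (simp add: log_concave_seqD(1)[OF assms])

lemma log_concave_seq_geometric_bound:
  assumes "log_concave_seq f" and pos: "0 < f c" and step: "f (c + 1) \<le> r * f c"
  shows "f (c + int m) \<le> r ^ m * f c"
proof (induction m)
  case (Suc m)
  have r0: "0 \<le> r"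
    using order_trans[OF log_concave_seqD(1)[OF assms(1), of "c + 1"] step] pos
    by (simp add: zero_le_mult_iff)
  have "f c * f (c + int (Suc m)) \<le> f (c + 1) * f (c + int m)"
    by (intro log_concave_seqD(2)[OF assms(1)]) auto
  also have "\<dots> \<le> (r * f c) * (r ^ m * f c)"
    by (intro mult_mono step Suc.IH mult_nonneg_nonneg r0 log_concave_seqD(1)[OF assms(1)])
  finally have "f c * f (c + int (Suc m)) \<le> f c * (r ^ Suc m * f c)"
    by (simp add: mult_ac)
  then show ?case
    using pos by simp
qed simp

text \<open>
  The convolution is a product of the Toeplitz matrices \<open>f (x - u)\<close> and \<open>g (u - y)\<close>, and the four-point
  inequality says that all \<open>2 \<times> 2\<close> minors of such a matrix are nonnegative. By Cauchy-Binet the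
  minors of the product are sums of products of minors of the factors.
\<close>
lemma log_concave_seq_convolution:
  fixes f g :: "int \<Rightarrow> real"
  assumes f: "log_concave_seq f" and g: "log_concave_seq g"
    and f0: "\<And>m. m < 0 \<Longrightarrow> f m = 0" and g0: "\<And>m. m < 0 \<Longrightarrow> g m = 0"
  shows "log_concave_seq (\<lambda>m. \<Sum>u\<in>{0..m}. f (m - u) * g u)"
proof -
  define h where "h m = (\<Sum>u\<in>{0..m}. f (m - u) * g u)" for m
  have toeplitz: "h (x - y) = (\<Sum>u\<in>{0..K}. f (x - u) * g (u - y))" if "0 \<le> y" "x \<le> K" for x y K
  proof -
    have "h (x - y) = (\<Sum>u\<in>{y..x}. f (x - u) * g (u - y))"
      unfolding h_def
      by (rule sum.reindex_bij_witness[of _ "\<lambda>u. u - y" "\<lambda>u. u + y"]) (auto simp: algebra_simps)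
    also have "\<dots> = (\<Sum>u\<in>{0..K}. f (x - u) * g (u - y))"
      by (rule sum.mono_neutral_left) (use that in \<open>auto simp: f0 g0 not_le\<close>)
    finally show ?thesis .
  qed
  have "h a * h d \<le> h b * h c" if "a \<le> b" "a \<le> c" and eq: "a + d = b + c" for a b c d
  proof -
    \<comment> \<open>The rows \<open>b \<le> d\<close> and the columns \<open>0 \<le> y\<close> give the minor with the entries \<open>h b\<close>, \<open>h a\<close>, \<open>h d\<close>, \<open>h c\<close>.\<close>
    define y where "y = b - a"
    define F where "F u v = f (b - u) * f (d - v)" for u v
    define G where "G u v = g u * g (v - y) - g (u - y) * g v" for u v
    have y: "0 \<le> y" and d: "b \<le> d" and K: "b \<le> d" "c = d - y" "a = b - y"
      using that by (auto simp: y_def)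
    let ?U = "{0..d}"
    have h: "h b = (\<Sum>u\<in>?U. f (b - u) * g u)" "h d = (\<Sum>v\<in>?U. f (d - v) * g v)"
      "h c = (\<Sum>v\<in>?U. f (d - v) * g (v - y))" "h a = (\<Sum>u\<in>?U. f (b - u) * g (u - y))"
      using toeplitz[of 0 b d] toeplitz[of 0 d d] toeplitz[of y d d] toeplitz[of y b d] y K
      by auto
    have det: "h b * h c - h a * h d = (\<Sum>u\<in>?U. \<Sum>v\<in>?U. F u v * G u v)"
      unfolding h sum_product F_def G_def
      by (simp add: sum_subtractf[symmetric] algebra_simps)
    have swap: "(\<Sum>u\<in>?U. \<Sum>v\<in>?U. F u v * G u v) = (\<Sum>u\<in>?U. \<Sum>v\<in>?U. F v u * G v u)"
      by (rule sum.swap)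
    have anti: "G v u = - G u v" for u v
      by (simp add: G_def)
    \<comment> \<open>Antisymmetrising in \<open>u\<close> and \<open>v\<close> turns every summand into a product of two minors of equal sign.\<close>
    have "2 * (h b * h c - h a * h d) = (\<Sum>u\<in>?U. \<Sum>v\<in>?U. (F u v - F v u) * G u v)"
    proof -
      have "2 * (h b * h c - h a * h d)
          = (\<Sum>u\<in>?U. \<Sum>v\<in>?U. F u v * G u v) + (\<Sum>u\<in>?U. \<Sum>v\<in>?U. F v u * G v u)"
        by (simp only: det swap[symmetric] mult_2)
      also have "\<dots> = (\<Sum>u\<in>?U. \<Sum>v\<in>?U. F u v * G u v + F v u * G v u)"
        by (simp only: sum.distrib)
      also have "\<dots> = (\<Sum>u\<in>?U. \<Sum>v\<in>?U. (F u v - F v u) * G u v)"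
        by (intro sum.cong refl) (subst (2) anti, simp add: left_diff_distrib)
      finally show ?thesis .
    qed
    also have "\<dots> \<ge> 0"
    proof (intro sum_nonneg)
      fix u v
      have sgn: "0 \<le> F u v - F v u \<and> 0 \<le> G u v" if "u \<le> v" for u v
      proof -
        have "f (b - v) * f (d - u) \<le> f (b - u) * f (d - v)"
          by (intro log_concave_seqD(2)[OF f]) (use that d in auto)
        moreover have "g (u - y) * g v \<le> g u * g (v - y)"
          by (intro log_concave_seqD(2)[OF g]) (use that y in auto)
        ultimately show ?thesis
          by (simp add: F_def G_def)
      qed
      show "0 \<le> (F u v - F v u) * G u v"
      proof (cases "u \<le> v")
        case True
        then show ?thesis using sgn by simp
      next
        case False
        then have "0 \<le> F v u - F u v" "0 \<le> G v u"
          using sgn[of v u] by auto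
        then show ?thesis
          unfolding anti[of v u] by (simp add: mult_nonpos_nonpos)
      qed
    qed
    finally show ?thesis by simp
  qed
  moreover have "0 \<le> h m" for m
    unfolding h_def by (intro sum_nonneg mult_nonneg_nonneg log_concave_seqD(1) f g)
  ultimately show ?thesis
    unfolding log_concave_seq_def h_def by blast
qed

lemma pmf_map_int:
  "pmf (map_pmf int p) m = (if m < 0 then 0 else pmf p (nat m))"
proof (cases "m < 0")
  case True
  then show ?thesis by (auto intro!: pmf_map_outside)
next
  case False
  then show ?thesis using pmf_map_inj'[of int p "nat m"] by simp
qed

text \<open>
  The support is an initial segment of the naturals on which successive ratios decrease; comparing
  telescoping products of \<open>j\<close> ratios started at \<open>a\<close> and at \<open>a + k\<close> gives the four-point inequality.
\<close>
lemma log_concave_pmf_imp_log_concave_seq: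
  assumes "log_concave_pmf p"
  shows "log_concave_seq (pmf (map_pmf int p))"
proof -
  have down: "0 < pmf p y" if "0 < pmf p x" "y \<le> x" for x y
  proof -
    have "enat x \<le> max_supp p"
      unfolding max_supp_def using that by (intro Sup_upper) auto
    then have "enat y \<le> max_supp p"
      using that(2) by (meson enat_ord_simps(1) order_trans)
    then show ?thesis
      using assms unfolding log_concave_pmf_def by blast
  qed
  have ratio1: "pmf p (Suc (Suc x)) / pmf p (Suc x) \<le> pmf p (Suc x) / pmf p x"
    if pos: "0 < pmf p (Suc (Suc x))" for x
  proof -
    have "enat (Suc (Suc x)) \<le> max_supp p"
      unfolding max_supp_def using that by (intro Sup_upper) auto
    then have "enat (Suc x) < max_supp p"
      using Suc_ile_eq by auto
    then have "pmf p x / pmf p (Suc x) \<le> pmf p (Suc x) / pmf p (Suc (Suc x))"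
      using assms unfolding log_concave_pmf_def by force
    moreover have "0 < pmf p (Suc x)" "0 < pmf p x"
      using down[OF pos] by auto
    ultimately show ?thesis
      using pos by (simp add: field_simps)
  qed
  have ratio: "pmf p (Suc (x + k)) / pmf p (x + k) \<le> pmf p (Suc x) / pmf p x"
    if "0 < pmf p (Suc (x + k))" for x k
    using that
  proof (induction k)
    case (Suc k)
    then show ?case
      using ratio1[of "x + k"] down[of "Suc (x + Suc k)" "Suc (x + k)"] by force
  qed simp
  have four: "pmf p a * pmf p (a + k + j) \<le> pmf p (a + k) * pmf p (a + j)" for a k j
  proof (cases "0 < pmf p (a + k + j)")
    case True
    then have pos: "0 < pmf p x" if "x \<le> a + k + j" for x
      using down that by blast
    have "pmf p (a + k + i) / pmf p (a + k) \<le> pmf p (a + i) / pmf p a" if "i \<le> j" for i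
      using that
    proof (induction i)
      case (Suc i)
      have "pmf p (a + k + Suc i) / pmf p (a + k)
          = pmf p (Suc (a + i + k)) / pmf p (a + i + k) * (pmf p (a + k + i) / pmf p (a + k))"
        using pos[of "a + k + i"] Suc.prems by (simp add: algebra_simps)
      also have "\<dots> \<le> pmf p (Suc (a + i)) / pmf p (a + i) * (pmf p (a + i) / pmf p a)"
        using Suc by (intro mult_mono ratio pos) auto
      also have "\<dots> = pmf p (a + Suc i) / pmf p a"
        using pos[of "a + i"] Suc.prems by simp
      finally show ?case .
    qed (use pos[of a] pos[of "a + k"] in auto)
    from this[of j] show ?thesis
      using pos[of a] pos[of "a + k"] by (simp add: field_simps)
  next
    case False
    then have "pmf p (a + k + j) = 0"
      by (simp add: not_less pmf_nonneg order_antisym)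
    then show ?thesis by simp
  qed
  show ?thesis
    unfolding log_concave_seq_def
  proof (intro conjI allI impI)
    fix a b c d :: int
    assume le: "a \<le> b" "a \<le> c" and eq: "a + d = b + c"
    show "pmf (map_pmf int p) a * pmf (map_pmf int p) d
        \<le> pmf (map_pmf int p) b * pmf (map_pmf int p) c"
    proof (cases "a < 0")
      case True
      then show ?thesis by (simp add: pmf_map_int)
    next
      case False
      then have "nat b = nat a + nat (b - a)" "nat c = nat a + nat (c - a)"
        "nat d = nat a + nat (b - a) + nat (c - a)"
        using le eq by auto
      then show ?thesis
        using four[of "nat a" "nat (b - a)" "nat (c - a)"] False le eq by (simp add: pmf_map_int)
    qed
  qed simp
qed

section \<open>Flatness of log-concave laws with large exponential moments\<close>

lemma integral_measure_pmf_count_space: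
  fixes f :: "'a \<Rightarrow> real"
  shows "measure_pmf.expectation p f = (\<integral>x. pmf p x * f x \<partial>count_space UNIV)"
  by (simp add: measure_pmf_eq_density integral_density)

text \<open>
  Up to a factor, the function \<open>q\<close> is the image of a geometric distribution under \<open>g\<close>, so that
  summability and the value of the sum come for free.
\<close>
lemma exponential_on_range:
  fixes g :: "nat \<Rightarrow> int" and s :: real
  assumes "0 < s" "inj g"
  defines "q \<equiv> (\<lambda>x. if x \<in> range g then exp (- s * real (inv g x)) else 0)"
  shows "integrable (count_space UNIV) q"
    and "(\<integral>x. q x \<partial>count_space UNIV) = 1 / (1 - exp (- s))"
proof -
  define p where "p = 1 - exp (- s)"
  have p: "0 < p" "p \<le> 1"
    using assms(1) by (auto simp: p_def)
  have q: "q x = pmf (map_pmf g (geometric_pmf p)) x / p" for x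
  proof (cases "x \<in> range g")
    case True
    then obtain m where m: "x = g m" by auto
    have "exp (- s) ^ m = exp (- s * real m)"
      by (simp add: exp_of_nat_mult[symmetric] mult_ac)
    then show ?thesis
      using p assms(2) by (simp add: m q_def pmf_map_inj' pmf_geometric) (simp add: p_def)
  next
    case False
    then show ?thesis
      unfolding q_def using pmf_map_outside[of x g "geometric_pmf p"] by auto
  qed
  show "integrable (count_space UNIV) q"
    unfolding q by (intro integrable_divide integrable_pmf)
  show "(\<integral>x. q x \<partial>count_space UNIV) = 1 / (1 - exp (- s))"
    unfolding q by (simp add: integral_pmf p_def)
qed

text \<open>
  Left of \<open>c\<close> the weight is at most 1, so this part contributes at most the total mass 1. Right of
  \<open>c\<close> the tail bound wins over the weight by \<open>exp (- e * m)\<close>, which sums to the second term.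
\<close>
lemma exponential_moment_bound:
  fixes V :: "int pmf" and c :: int and e :: real
  assumes "0 < e" and tail: "\<And>m. pmf V (c + int m) \<le> exp (- 2 * e * real m)"
  shows "measure_pmf.expectation V (\<lambda>x. exp (e * real_of_int (x - c))) \<le> 1 + 1 / (1 - exp (- e))"
proof -
  define q where
    "q x = (if x \<in> range (\<lambda>m. c + int m) then exp (- e * real (inv (\<lambda>m. c + int m) x)) else 0)"
    for x
  have inj: "inj (\<lambda>m. c + int m)" by (simp add: inj_def)
  note q_int = exponential_on_range[OF assms(1) inj, folded q_def[abs_def]]
  have "measure_pmf.expectation V (\<lambda>x. exp (e * real_of_int (x - c)))
      \<le> (\<integral>x. pmf V x + q x \<partial>count_space UNIV)"
    unfolding integral_measure_pmf_count_space
  proof (rule integral_mono')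
    show "integrable (count_space UNIV) (\<lambda>x. pmf V x + q x)"
      by (intro Bochner_Integration.integrable_add integrable_pmf q_int)
    fix x
    show "pmf V x * exp (e * real_of_int (x - c)) \<le> pmf V x + q x"
    proof (cases "x < c")
      case True
      then have "exp (e * real_of_int (x - c)) \<le> 1"
        using assms(1) by (simp add: mult_le_0_iff)
      then have "pmf V x * exp (e * real_of_int (x - c)) \<le> pmf V x"
        by (intro mult_left_le) auto
      then show ?thesis
        by (rule order_trans) (simp add: q_def)
    next
      case False
      define m where "m = nat (x - c)"
      have x: "x = c + int m" using False by (simp add: m_def)
      have "pmf V x * exp (e * real_of_int (x - c)) \<le> exp (- 2 * e * real m) * exp (e * real m)"
        unfolding x using tail[of m] by (intro mult_mono) auto
      also have "\<dots> = exp (- e * real m)"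
        by (simp add: exp_add[symmetric])
      also have "\<dots> = q x"
        unfolding x q_def using inv_f_f[OF inj, of m] by simp
      finally show ?thesis
        by (simp add: add.commute add_increasing2)
    qed
  qed (auto simp: q_def)
  also have "\<dots> = 1 + 1 / (1 - exp (- e))"
    using q_int by (simp add: integrable_pmf integral_pmf)
  finally show ?thesis .
qed

lemma pmf_map_uminus_int: "pmf (map_pmf uminus V) x = pmf V (- x)" for x :: int
  using pmf_map_inj'[of uminus V "- x"] by (simp add: inj_def)

text \<open>
  A ratio of at most \<open>exp (- 2 * e)\<close> at \<open>c\<close> persists to the right of \<open>c\<close>. This tail beats the weight
  \<open>exp (e * (x - c))\<close>, and the moment is then too small.
\<close>
lemma log_concave_seq_step:
  fixes V :: "int pmf" and c :: int and e :: real
  assumes V: "log_concave_seq (pmf V)" and "0 < e" and pos: "0 < pmf V c"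
    and big: "1 + 1 / (1 - exp (- e)) < measure_pmf.expectation V (\<lambda>x. exp (e * real_of_int (x - c)))"
  shows "exp (- 2 * e) * pmf V c < pmf V (c + 1)"
proof (rule ccontr)
  assume "\<not> ?thesis"
  then have "pmf V (c + int m) \<le> exp (- 2 * e) ^ m * pmf V c" for m
    by (intro log_concave_seq_geometric_bound[OF V pos]) auto
  moreover have "exp (- 2 * e) ^ m * pmf V c \<le> exp (- 2 * e * real m)" for m
    using pmf_le_1[of V c] by (simp add: exp_of_nat_mult[symmetric] mult_ac mult_left_le)
  ultimately have "pmf V (c + int m) \<le> exp (- 2 * e * real m)" for m
    using order_trans by blast
  from exponential_moment_bound[OF \<open>0 < e\<close> this] big show False
    by simp
qed

text \<open>
  The threshold \<open>1 + 1 / (1 - exp (- e))\<close> is the bound of \<open>exponential_moment_bound\<close>: exceeding it in both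
  directions rules out geometric decay with rate \<open>2 * e\<close> on either side of \<open>c\<close>.
\<close>
definition spread :: "real \<Rightarrow> int pmf \<Rightarrow> int \<Rightarrow> bool" where
  "spread e V c \<longleftrightarrow>
     1 + 1 / (1 - exp (- e)) < measure_pmf.expectation V (\<lambda>x. exp (e * real_of_int (x - c))) \<and>
     1 + 1 / (1 - exp (- e)) < measure_pmf.expectation V (\<lambda>x. exp (- e * real_of_int (x - c)))"

lemma spread_reflect: "spread e (map_pmf uminus V) (- c) \<longleftrightarrow> spread e V c"
proof -
  have "- real_of_int x + real_of_int c = - (real_of_int x - real_of_int c)" for x by simp
  then show ?thesis
    unfolding spread_def by (auto simp: algebra_simps)
qed

text \<open>
  If \<open>V\<close> vanished at \<open>c\<close>, large moments in both directions would still force mass on both sides of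
  \<open>c\<close>, which the four-point inequality forbids.
\<close>
lemma spread_imp_pmf_pos:
  assumes V: "log_concave_seq (pmf V)" and "0 < e" and c: "spread e V c"
  shows "0 < pmf V c"
proof -
  have right: "\<exists>d>c. 0 < pmf V d"
    if V: "log_concave_seq (pmf V)" and c: "spread e V c" and z: "pmf V c = 0" for V c
  proof (rule ccontr)
    assume "\<not> ?thesis"
    then have "pmf V (c + int (Suc m)) \<le> 0" for m
      by (meson not_less zless_iff_Suc_zadd)
    then have "pmf V (c + int m) \<le> 0" for m
      using z by (cases m) simp_all
    then have "pmf V (c + int m) \<le> exp (- 2 * e * real m)" for m
      by (rule order_trans) simp
    from exponential_moment_bound[OF \<open>0 < e\<close> this] c show False
      unfolding spread_def by linarith
  qed
  show ?thesis
  proof (rule ccontr)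
    assume "\<not> ?thesis"
    then have z: "pmf V c = 0"
      using pmf_nonneg[of V c] by linarith
    from right[OF V c z] obtain d where d: "c < d" "0 < pmf V d" by auto
    have "log_concave_seq (pmf (map_pmf uminus V))"
      using log_concave_seq_reflect[OF V] by (simp add: pmf_map_uminus_int[abs_def])
    from right[OF this, of "- c"] obtain d' where "- c < d'" "0 < pmf V (- d')"
      using c z spread_reflect[of e V c] by (auto simp: pmf_map_uminus_int)
    then obtain a where a: "a < c" "0 < pmf V a"
      by (intro that[of "- d'"]) auto
    have "pmf V a * pmf V d \<le> pmf V c * pmf V (a + d - c)"
      by (intro log_concave_seqD(2)[OF V]) (use a d in auto)
    then show False
      using mult_pos_pos[OF a(2) d(2)] z by simp
  qed
qed

text \<open>
  The lower bound of \<open>log_concave_seq_step\<close>, applied to the reflected law at \<open>c + 1\<close>, bounds the ratio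
  of \<open>V\<close> at \<open>c\<close> from above, and log-concavity carries this bound to all points right of \<open>c\<close>; the
  left side follows by reflection.
\<close>
lemma spread_imp_slow_variation:
  assumes V: "log_concave_seq (pmf V)" and "0 < e"
    and c: "spread e V (c - 1)" "spread e V c" "spread e V (c + 1)"
  shows "pmf V (c + m) \<le> exp (2 * e * \<bar>real_of_int m\<bar>) * pmf V c"
proof -
  have up: "pmf V (c + int k) \<le> exp (2 * e * real k) * pmf V c"
    if V: "log_concave_seq (pmf V)" and c: "spread e V c" "spread e V (c + 1)" for V c k
  proof -
    have V': "log_concave_seq (pmf (map_pmf uminus V))"
      using log_concave_seq_reflect[OF V] by (simp add: pmf_map_uminus_int[abs_def])
    have pos: "0 < pmf V c" "0 < pmf V (c + 1)"
      using spread_imp_pmf_pos[OF V \<open>0 < e\<close>] c by auto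
    have sp: "spread e (map_pmf uminus V) (- (c + 1))"
      using c(2) by (subst spread_reflect)
    then have "exp (- 2 * e) * pmf V (c + 1) < pmf V c"
      using log_concave_seq_step[OF V' \<open>0 < e\<close> _ sp[unfolded spread_def, THEN conjunct1]] pos
      by (simp add: pmf_map_uminus_int add.commute)
    then have "pmf V (c + 1) \<le> exp (2 * e) * pmf V c"
      by (simp add: exp_minus field_simps)
    from log_concave_seq_geometric_bound[OF V pos(1) this, of k] show ?thesis
      by (simp add: exp_of_nat_mult[symmetric] mult_ac)
  qed
  show ?thesis
  proof (cases "0 \<le> m")
    case True
    then show ?thesis using up[OF V c(2,3), of "nat m"] by simp
  next
    case False
    have V': "log_concave_seq (pmf (map_pmf uminus V))"
      using log_concave_seq_reflect[OF V] by (simp add: pmf_map_uminus_int[abs_def])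
    have "spread e (map_pmf uminus V) (- c)" "spread e (map_pmf uminus V) (- c + 1)"
      using c(1,2) spread_reflect[of e V c] spread_reflect[of e V "c - 1"]
      by (auto simp: algebra_simps)
    from up[OF V' this, of "nat (- m)"] False show ?thesis
      by (simp add: pmf_map_uminus_int add.commute)
  qed
qed

text \<open>
  Moving the centre by a fixed integer multiplies the moments by constants, so the growth bound also
  holds around \<open>c n + m\<close>. Read from \<open>c n + m\<close> back to \<open>c n\<close>, it gives the lower bound that is needed for the
  ratio to converge to 1.
\<close>
lemma slow_variation_limit:
  fixes V :: "nat \<Rightarrow> int pmf" and c :: "nat \<Rightarrow> int" and d :: real
  assumes V: "\<And>n. log_concave_seq (pmf (V n))" and "0 < d"
    and plus: "\<And>e. 0 < e \<Longrightarrow> e < d \<Longrightarrow>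
      filterlim (\<lambda>n. measure_pmf.expectation (V n) (\<lambda>x. exp (e * real_of_int (x - c n)))) at_top sequentially"
    and minus: "\<And>e. 0 < e \<Longrightarrow> e < d \<Longrightarrow>
      filterlim (\<lambda>n. measure_pmf.expectation (V n) (\<lambda>x. exp (- e * real_of_int (x - c n)))) at_top sequentially"
  shows "\<forall>\<^sub>F n in sequentially. 0 < pmf (V n) (c n)"
    and "0 < e \<Longrightarrow> \<forall>\<^sub>F n in sequentially. \<forall>m.
      pmf (V n) (c n + m) \<le> exp (e * \<bar>real_of_int m\<bar>) * pmf (V n) (c n)"
    and "(\<lambda>n. pmf (V n) (c n + m) / pmf (V n) (c n)) \<longlonglongrightarrow> 1"
proof -
  have spread: "\<forall>\<^sub>F n in sequentially. spread e (V n) (c n + k)" if "0 < e" "e < d" for e k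
  proof -
    have *: "filterlim (\<lambda>n. measure_pmf.expectation (V n) (\<lambda>x. exp (s * real_of_int (x - (c n + k))))) at_top sequentially"
      if "filterlim (\<lambda>n. measure_pmf.expectation (V n) (\<lambda>x. exp (s * real_of_int (x - c n)))) at_top sequentially" for s
    proof -
      have "measure_pmf.expectation (V n) (\<lambda>x. exp (s * real_of_int (x - (c n + k))))
          = exp (- s * real_of_int k) * measure_pmf.expectation (V n) (\<lambda>x. exp (s * real_of_int (x - c n)))" for n
        by (subst integral_mult_right_zero[symmetric], rule Bochner_Integration.integral_cong)
          (auto simp: exp_add[symmetric] algebra_simps)
      then show ?thesis
        using filterlim_tendsto_pos_mult_at_top[OF tendsto_const _ that, of "exp (- s * real_of_int k)"] by simp
    qed
    show ?thesis
      unfolding spread_def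
      using *[OF plus[OF that]] *[OF minus[OF that]]
      by (intro eventually_conj) (auto simp: filterlim_at_top_dense)
  qed
  have bound: "\<forall>\<^sub>F n in sequentially. \<forall>m.
      pmf (V n) (c n + k + m) \<le> exp (e * \<bar>real_of_int m\<bar>) * pmf (V n) (c n + k)" if "0 < e" for e k
  proof -
    \<comment> \<open>Spreading at rate \<open>s\<close> gives growth at rate \<open>2 * s\<close>.\<close>
    define s where "s = min (e / 2) (d / 2)"
    have s: "0 < s" "s < d" "2 * s \<le> e"
      using that \<open>0 < d\<close> by (auto simp: s_def)
    show ?thesis
      using spread[OF s(1,2), of "k - 1"] spread[OF s(1,2), of k] spread[OF s(1,2), of "k + 1"]
    proof eventually_elim
      case (elim n)
      show ?case
      proof
        fix m
        have "pmf (V n) (c n + k + m) \<le> exp (2 * s * \<bar>real_of_int m\<bar>) * pmf (V n) (c n + k)"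
          using elim by (intro spread_imp_slow_variation V s) (auto simp: algebra_simps)
        also have "\<dots> \<le> exp (e * \<bar>real_of_int m\<bar>) * pmf (V n) (c n + k)"
          using s(3) by (intro mult_right_mono) (auto intro: mult_right_mono)
        finally show "pmf (V n) (c n + k + m) \<le> exp (e * \<bar>real_of_int m\<bar>) * pmf (V n) (c n + k)" .
      qed
    qed
  qed
  show pos: "\<forall>\<^sub>F n in sequentially. 0 < pmf (V n) (c n)"
  proof -
    have "\<forall>\<^sub>F n in sequentially. spread (d / 2) (V n) (c n + 0)"
      using \<open>0 < d\<close> by (intro spread) auto
    then show ?thesis
      by eventually_elim (rule spread_imp_pmf_pos[OF V], use \<open>0 < d\<close> in auto)
  qed
  show "\<forall>\<^sub>F n in sequentially. \<forall>m.
      pmf (V n) (c n + m) \<le> exp (e * \<bar>real_of_int m\<bar>) * pmf (V n) (c n)" if "0 < e" for e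
    using bound[OF that, of 0] by simp
  show "(\<lambda>n. pmf (V n) (c n + m) / pmf (V n) (c n)) \<longlonglongrightarrow> 1"
  proof -
    let ?r = "\<lambda>n. pmf (V n) (c n + m) / pmf (V n) (c n)"
    have between: "\<forall>\<^sub>F n in sequentially. exp (- e) \<le> ?r n \<and> ?r n \<le> exp e" if "0 < e" for e
    proof -
      \<comment> \<open>For fixed \<open>m\<close> this rate keeps the total growth over \<open>\<bar>m\<bar>\<close> steps below \<open>exp e\<close>.\<close>
      define s where "s = e / (1 + \<bar>real_of_int m\<bar>)"
      have s: "0 < s" "s * \<bar>real_of_int m\<bar> \<le> e"
        using that by (auto simp: s_def field_simps)
      show ?thesis
        using bound[OF s(1), of 0] bound[OF s(1), of m] pos
      proof eventually_elim
        case (elim n)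
        have es: "exp (s * \<bar>real_of_int m\<bar>) \<le> exp e" using s by simp
        have "pmf (V n) (c n + m) \<le> exp (s * \<bar>real_of_int m\<bar>) * pmf (V n) (c n)"
          using elim(1)[rule_format, of m] by simp
        also have "\<dots> \<le> exp e * pmf (V n) (c n)"
          by (rule mult_right_mono[OF es]) simp
        finally have 1: "pmf (V n) (c n + m) \<le> exp e * pmf (V n) (c n)" .
        have "pmf (V n) (c n) \<le> exp (s * \<bar>real_of_int m\<bar>) * pmf (V n) (c n + m)"
          using elim(2)[rule_format, of "- m"] by simp
        also have "\<dots> \<le> exp e * pmf (V n) (c n + m)"
          by (rule mult_right_mono[OF es]) simp
        finally show ?case
          using 1 elim(3) by (simp add: exp_minus field_simps)
      qed
    qed
    have lim: "((\<lambda>e::real. exp e) \<longlongrightarrow> 1) (at_right 0)" "((\<lambda>e::real. exp (- e)) \<longlongrightarrow> 1) (at_right 0)"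
      by (auto intro!: tendsto_eq_intros)
    show ?thesis
    proof (rule order_tendstoI)
      fix a :: real assume "a < 1"
      then have "\<forall>\<^sub>F e in at_right 0. a < exp (- e)"
        using order_tendstoD(1)[OF lim(2)] by simp
      then obtain e where "0 < e" "a < exp (- e)"
        using eventually_happens[OF eventually_conj[OF _ eventually_at_right_less[of "0::real"]]] by force
      then show "\<forall>\<^sub>F n in sequentially. a < ?r n"
        using between[of e] by (auto elim!: eventually_mono)
    next
      fix a :: real assume "1 < a"
      then have "\<forall>\<^sub>F e in at_right 0. exp e < a"
        using order_tendstoD(2)[OF lim(1)] by simp
      then obtain e where "0 < e" "exp e < a"
        using eventually_happens[OF eventually_conj[OF _ eventually_at_right_less[of "0::real"]]] by force
      then show "\<forall>\<^sub>F n in sequentially. ?r n < a"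
        using between[of e] by (auto elim!: eventually_mono)
    qed
  qed
qed

section \<open>Laws of finite sequences and exponential tilting\<close>

primrec list_law :: "nat \<Rightarrow> (nat \<Rightarrow> nat pmf) \<Rightarrow> nat list pmf" where
  "list_law 0 \<nu> = return_pmf []"
| "list_law (Suc n) \<nu> = bind_pmf (\<nu> 0) (\<lambda>x. map_pmf ((#) x) (list_law n (\<lambda>i. \<nu> (Suc i))))"

lemma length_list_law: "xs \<in> set_pmf (list_law n \<nu>) \<Longrightarrow> length xs = n"
  by (induction n arbitrary: \<nu> xs) auto

lemma pmf_list_law:
  "pmf (list_law n \<nu>) xs = (if length xs = n then \<Prod>i<n. pmf (\<nu> i) (xs ! i) else 0)"
proof (induction n arbitrary: \<nu> xs)
  case (Suc n)
  show ?case
  proof (cases xs)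
    case Nil
    then show ?thesis
      by (auto simp: pmf_eq_0_set_pmf)
  next
    case (Cons y ys)
    let ?L = "list_law n (\<lambda>i. \<nu> (Suc i))"
    have "pmf (map_pmf ((#) x) ?L) (y # ys) = indicator {y} x * pmf ?L ys" for x
      using pmf_map_inj'[of "(#) y" ?L ys]
      by (cases "x = y") (auto simp: inj_def intro: pmf_map_outside)
    then have "pmf (list_law (Suc n) \<nu>) xs = pmf (\<nu> 0) y * pmf ?L ys"
      by (simp add: Cons pmf_bind measure_pmf_single)
    then show ?thesis
      unfolding Suc.IH Cons by (simp add: prod.lessThan_Suc_shift del: prod.lessThan_Suc)
  qed
qed simp

lemma list_law_append:
  "list_law (l + m) \<nu> =
     bind_pmf (list_law l \<nu>) (\<lambda>as. map_pmf ((@) as) (list_law m (\<lambda>i. \<nu> (l + i))))"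
proof (induction l arbitrary: \<nu>)
  case (Suc l)
  have "(@) (x # as) = (\<lambda>ys. x # as @ ys)" for x :: nat and as
    by auto
  with Suc show ?case
    by (simp add: map_bind_pmf bind_map_pmf bind_assoc_pmf pmf.map_comp o_def)
next
  case 0
  have "(@) [] = (\<lambda>ys :: nat list. ys)" by auto
  then show ?case
    by (simp add: bind_return_pmf)
qed

definition sum_law :: "nat \<Rightarrow> (nat \<Rightarrow> nat pmf) \<Rightarrow> int pmf" where
  "sum_law n \<nu> = map_pmf (\<lambda>xs. int (sum_list xs)) (list_law n \<nu>)"

lemma log_concave_seq_sum_law:
  assumes "\<And>i. log_concave_seq (pmf (map_pmf int (\<nu> i)))"
  shows "log_concave_seq (pmf (sum_law n \<nu>))"
  using assms
proof (induction n arbitrary: \<nu>)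
  case 0
  show ?case
    by (auto simp: sum_law_def log_concave_seq_def indicator_def)
next
  case (Suc n)
  define S where "S = sum_law n (\<lambda>i. \<nu> (Suc i))"
  have S: "log_concave_seq (pmf S)"
    unfolding S_def by (intro Suc)
  have S0: "pmf S m = 0" if "m < 0" for m
    using that by (auto simp: S_def sum_law_def intro!: pmf_map_outside)
  have "pmf (sum_law (Suc n) \<nu>) = (\<lambda>m. \<Sum>u\<in>{0..m}. pmf S (m - u) * pmf (map_pmf int (\<nu> 0)) u)"
  proof
    fix m
    have shift: "pmf (map_pmf ((+) u) S) m = pmf S (m - u)" for u
      using pmf_map_inj'[of "(+) u" S "m - u"] by (simp add: inj_def)
    have "sum_law (Suc n) \<nu> = bind_pmf (map_pmf int (\<nu> 0)) (\<lambda>u. map_pmf ((+) u) S)"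
      by (simp add: sum_law_def S_def map_bind_pmf bind_map_pmf pmf.map_comp o_def)
    then have "pmf (sum_law (Suc n) \<nu>) m = measure_pmf.expectation (map_pmf int (\<nu> 0)) (\<lambda>u. pmf S (m - u))"
      by (simp only: pmf_bind shift)
    also have "\<dots> = (\<Sum>u\<in>{0..m}. pmf S (m - u) * pmf (map_pmf int (\<nu> 0)) u)"
    proof (rule integral_measure_pmf_real)
      fix u assume "u \<in> set_pmf (map_pmf int (\<nu> 0))" "pmf S (m - u) \<noteq> 0"
      then show "u \<in> {0..m}"
        using S0[of "m - u"] by force
    qed simp
    finally show "pmf (sum_law (Suc n) \<nu>) m = (\<Sum>u\<in>{0..m}. pmf S (m - u) * pmf (map_pmf int (\<nu> 0)) u)" .
  qed
  moreover have "log_concave_seq (\<lambda>m. \<Sum>u\<in>{0..m}. pmf S (m - u) * pmf (map_pmf int (\<nu> 0)) u)"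
    by (intro log_concave_seq_convolution S S0 Suc.prems) (simp_all add: pmf_map_int)
  ultimately show ?case
    by presburger
qed

lemma part_fun_pos:
  assumes "0 < lam" "part_fun p lam < \<infinity>"
  shows "0 < enn2real (part_fun p lam)"
proof (rule ccontr)
  assume "\<not> ?thesis"
  then have "enn2real (part_fun p lam) = 0"
    using enn2real_nonneg[of "part_fun p lam"] by linarith
  then have "pmf (tilted p lam) x = 0" for x
    by (simp add: pmf_tilted[OF assms])
  then show False
    using set_pmf_not_empty[of "tilted p lam"] by (auto simp: pmf_eq_0_set_pmf)
qed

lemma pmf_tilted_exp:
  assumes "part_fun p (exp t) < \<infinity>"
  shows "pmf (tilted p (exp t)) x = exp (t * real x) * pmf p x / enn2real (part_fun p (exp t))"
  using pmf_tilted[of "exp t" p x] assms by (simp add: exp_of_nat2_mult)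

text \<open>
  The factor \<open>exp (t * m)\<close> is the same on both sides of the four-point inequality since \<open>a + d = b + c\<close>.
\<close>
lemma log_concave_seq_tilted:
  assumes p: "log_concave_seq (pmf (map_pmf int p))" and fin: "part_fun p (exp t) < \<infinity>"
  shows "log_concave_seq (pmf (map_pmf int (tilted p (exp t))))"
proof -
  define Z where "Z = enn2real (part_fun p (exp t))"
  have Z: "0 < Z" unfolding Z_def by (intro part_fun_pos fin) simp
  have eq: "pmf (map_pmf int (tilted p (exp t))) m = exp (t * real_of_int m) * pmf (map_pmf int p) m / Z" for m
    by (simp add: pmf_map_int pmf_tilted_exp[OF fin] Z_def)
  show ?thesis
    unfolding log_concave_seq_def
  proof (intro conjI allI impI)
    fix a b c d :: int
    let ?q = "pmf (map_pmf int p)"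
    assume "a \<le> b" "a \<le> c" and e: "a + d = b + c"
    then have "?q a * ?q d \<le> ?q b * ?q c"
      by (intro log_concave_seqD(2)[OF p])
    then have "exp (t * real_of_int (a + d)) * (?q a * ?q d) \<le> exp (t * real_of_int (b + c)) * (?q b * ?q c)"
      unfolding e by (rule mult_left_mono) simp
    then show "pmf (map_pmf int (tilted p (exp t))) a * pmf (map_pmf int (tilted p (exp t))) d
      \<le> pmf (map_pmf int (tilted p (exp t))) b * pmf (map_pmf int (tilted p (exp t))) c"
      unfolding eq using Z by (simp add: field_simps exp_add)
  qed simp
qed

text \<open>
  Written as integrals over counting measure, the two sides have the same integrand; if these
  integrals diverge, both sides are 0 by convention.
\<close>
lemma expectation_list_law_tilt:
  fixes g :: "nat list \<Rightarrow> real"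
  assumes fin: "\<And>i. part_fun (\<nu> i) (exp t) < \<infinity>"
  shows "measure_pmf.expectation (list_law n \<nu>) (\<lambda>xs. exp (t * real (sum_list xs)) * g xs)
    = exp (log_mgf_sum \<nu> n t) * measure_pmf.expectation (list_law n (\<lambda>i. tilted (\<nu> i) (exp t))) g"
proof -
  let ?Z = "\<lambda>i. enn2real (part_fun (\<nu> i) (exp t))"
  have Z: "0 < ?Z i" for i by (intro part_fun_pos fin) simp
  have M: "exp (log_mgf_sum \<nu> n t) = (\<Prod>i<n. ?Z i)"
    using Z by (simp add: log_mgf_sum_def exp_sum)
  have pmf: "pmf (list_law n \<nu>) xs * exp (t * real (sum_list xs))
      = exp (log_mgf_sum \<nu> n t) * pmf (list_law n (\<lambda>i. tilted (\<nu> i) (exp t))) xs" for xs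
  proof (cases "length xs = n")
    case True
    have "exp (t * real (sum_list xs)) = (\<Prod>i<n. exp (t * real (xs ! i)))"
      using True by (simp add: sum_list_sum_nth atLeast0LessThan sum_distrib_left exp_sum)
    moreover have "?Z i \<noteq> 0" for i using Z[of i] by simp
    ultimately show ?thesis
      using True by (simp add: pmf_list_law M pmf_tilted_exp[OF fin] prod.distrib[symmetric] mult_ac)
  qed (simp add: pmf_list_law)
  show ?thesis
    unfolding integral_measure_pmf_count_space
    by (simp add: mult.assoc[symmetric] pmf integral_mult_right_zero[symmetric])
qed

lemma expectation_exp_sum_tilted:
  assumes "\<And>i. part_fun (\<nu> i) (exp t) < \<infinity>" "\<And>i. part_fun (\<nu> i) (exp (t + e)) < \<infinity>"
  shows "measure_pmf.expectation (list_law n (\<lambda>i. tilted (\<nu> i) (exp t))) (\<lambda>xs. exp (e * real (sum_list xs)))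
    = exp (log_mgf_sum \<nu> n (t + e) - log_mgf_sum \<nu> n t)"
proof -
  have "exp (log_mgf_sum \<nu> n t) * measure_pmf.expectation (list_law n (\<lambda>i. tilted (\<nu> i) (exp t))) (\<lambda>xs. exp (e * real (sum_list xs)))
      = measure_pmf.expectation (list_law n \<nu>) (\<lambda>xs. exp ((t + e) * real (sum_list xs)) * 1)"
    by (simp add: expectation_list_law_tilt[OF assms(1), symmetric] exp_add[symmetric] algebra_simps)
  also have "\<dots> = exp (log_mgf_sum \<nu> n (t + e))"
    by (subst expectation_list_law_tilt[OF assms(2)]) simp
  finally show ?thesis
    by (simp add: exp_diff field_simps)
qed

text \<open>
  A function that is not integrable has integral 0, whereas this expectation is positive.
\<close>
lemma integrable_exp_sum_tilted:
  assumes "\<And>i. part_fun (\<nu> i) (exp t) < \<infinity>" "\<And>i. part_fun (\<nu> i) (exp (t + e)) < \<infinity>"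
  shows "integrable (list_law n (\<lambda>i. tilted (\<nu> i) (exp t))) (\<lambda>xs. exp (e * real (sum_list xs)))"
  using expectation_exp_sum_tilted[OF assms, of n] not_integrable_integral_eq by force

lemma log_mgf_sum_shift:
  "log_mgf_sum (\<lambda>i. \<nu> (l + i)) m t = log_mgf_sum \<nu> (l + m) t - log_mgf_sum \<nu> l t"
  by (induction m) (auto simp: log_mgf_sum_def)

lemma part_fun_finite:
  assumes "0 < x" "ereal x < lambda_max \<nu>"
  shows "part_fun (\<nu> i) x < \<infinity>"
proof -
  obtain y where y: "x < y" "part_fun (\<nu> i) y < \<infinity>"
    using assms unfolding lambda_max_def less_Sup_iff by auto
  have "part_fun (\<nu> i) x \<le> part_fun (\<nu> i) y"
    unfolding part_fun_def using assms(1) y(1)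
    by (intro suminf_le ennreal_leI mult_right_mono power_mono) auto
  then show ?thesis using y(2) by auto
qed

text \<open>
  The partition function is a power series in \<open>exp s\<close> that converges beyond \<open>exp t\<close>, so it may be
  differentiated termwise; the logarithmic derivative is then the mean of the tilted law.
\<close>
lemma log_part_fun_derivative:
  assumes "t < u" and fin: "part_fun p (exp u) < \<infinity>"
  shows "integrable (tilted p (exp t)) real"
    and "((\<lambda>s. ln (enn2real (part_fun p (exp s)))) has_real_derivative
            measure_pmf.expectation (tilted p (exp t)) real) (at t)"
proof -
  define K where "K = exp u"
  define x where "x = exp t"
  have xK: "0 < x" "x < K" using assms by (auto simp: x_def K_def)
  define G where "G y = (\<Sum>z. pmf p z * y ^ z)" for y :: real
  have sumK: "summable (\<lambda>z. pmf p z * K ^ z)"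
    using fin summable_suminf_not_top[of "\<lambda>z. K ^ z * pmf p z"]
    by (simp add: part_fun_def K_def mult.commute)
  have sumy: "summable (\<lambda>z. pmf p z * y ^ z)" if "norm y < K" for y
    using powser_inside[OF sumK, of y] that xK by simp
  have part: "part_fun p y = ennreal (G y)" if "0 < y" "y < K" for y
    unfolding part_fun_def G_def using that sumy[of y]
    by (subst suminf_ennreal2) (auto simp: mult.commute)
  have G0: "0 \<le> G y" if "0 < y" "y < K" for y
    unfolding G_def using that sumy[of y] by (intro suminf_nonneg) auto
  have fx: "part_fun p (exp t) < \<infinity>"
    using part[of x] xK by (simp add: x_def)
  have Gx: "0 < G x"
    using part_fun_pos[OF _ fx] part[of x] G0[of x] xK by (simp add: x_def)
  have "summable (\<lambda>z. diffs (pmf p) z * x ^ z)"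
    by (rule termdiff_converges[of x K]) (use sumy xK in auto)
  from diffs_equiv[OF this]
  have sums: "(\<lambda>z. real z * pmf p z * x ^ (z - Suc 0)) sums (\<Sum>z. diffs (pmf p) z * x ^ z)"
    by simp
  define D where "D = (\<Sum>z. diffs (pmf p) z * x ^ z)"
  have "(\<lambda>z. real z * pmf p z * x ^ (z - Suc 0) * (x / G x)) sums (D * (x / G x))"
    unfolding D_def by (intro sums_mult2 sums)
  moreover have "real z * pmf p z * x ^ (z - Suc 0) * (x / G x) = pmf (tilted p (exp t)) z * real z" for z
    using pmf_tilted[OF _ fx, of z] part[of x] G0[of x] xK by (cases z) (auto simp: x_def)
  ultimately have mean: "(\<lambda>z. pmf (tilted p (exp t)) z * real z) sums (D * (x / G x))"
    by simp
  then have int: "integrable (count_space UNIV) (\<lambda>z. pmf (tilted p (exp t)) z * real z)"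
    by (simp add: integrable_count_space_nat_iff sums_iff)
  then show "integrable (tilted p (exp t)) real"
    by (simp add: measure_pmf_eq_density integrable_density)
  have E: "measure_pmf.expectation (tilted p (exp t)) real = D * (x / G x)"
    unfolding integral_measure_pmf_count_space
    using integral_count_space_nat[OF int] mean by (simp add: sums_iff)
  have "DERIV G x :> D"
    unfolding G_def[abs_def] D_def by (rule termdiffs_strong[OF sumK]) (use xK in auto)
  then have "((\<lambda>s. ln (G (exp s))) has_real_derivative (D * (x / G x))) (at t)"
    using Gx by (auto intro!: derivative_eq_intros DERIV_chain2[of G] simp: x_def)
  then show "((\<lambda>s. ln (enn2real (part_fun p (exp s)))) has_real_derivative
            measure_pmf.expectation (tilted p (exp t)) real) (at t)"
    unfolding E
  proof (rule has_field_derivative_transform_within_open[where S = "{..<u}"])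
    fix s assume "s \<in> {..<u}"
    then show "ln (G (exp s)) = ln (enn2real (part_fun p (exp s)))"
      using part[of "exp s"] G0[of "exp s"] by (simp add: K_def)
  qed (use assms in auto)
qed

section \<open>Conditional laws as quotients of mixtures\<close>

lemma expectation_bind_pmf:
  fixes f :: "'b \<Rightarrow> real"
  assumes "\<And>x. \<bar>f x\<bar> \<le> B"
  shows "measure_pmf.expectation (bind_pmf p q) f = measure_pmf.expectation p (\<lambda>x. measure_pmf.expectation (q x) f)"
  unfolding measure_pmf_bind
proof (rule integral_bind[where K = "count_space UNIV" and B = B and B' = 1])
  show "(\<lambda>x. measure_pmf (q x)) \<in> measurable (measure_pmf p) (subprob_algebra (count_space UNIV))"
    using measurable_measure_pmf[of q] by simp
qed (use assms in \<open>auto simp: measure_pmf.emeasure_space_1\<close>)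

lemma expectation_shift_int:
  fixes h :: "int \<Rightarrow> real"
  shows "measure_pmf.expectation V (\<lambda>x. h (x + s)) = (\<integral>j. pmf V (j - s) * h j \<partial>count_space UNIV)"
proof -
  have "pmf (map_pmf (\<lambda>x. x + s) V) j = pmf V (j - s)" for j
    using pmf_map_inj'[of "\<lambda>x. x + s" V "j - s"] by (simp add: inj_def)
  then show ?thesis
    using integral_measure_pmf_count_space[of "map_pmf (\<lambda>x. x + s) V" h] by simp
qed

lemma integral_tendsto_eventually_dominated:
  fixes s :: "nat \<Rightarrow> 'a \<Rightarrow> real"
  assumes "f \<in> borel_measurable M" "\<And>n. s n \<in> borel_measurable M" "integrable M w"
    and lim: "\<And>x. (\<lambda>n. s n x) \<longlonglongrightarrow> f x"
    and bound: "\<forall>\<^sub>F n in sequentially. \<forall>x. \<bar>s n x\<bar> \<le> w x"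
  shows "(\<lambda>n. integral\<^sup>L M (s n)) \<longlonglongrightarrow> integral\<^sup>L M f"
proof -
  obtain k where k: "\<And>n x. k \<le> n \<Longrightarrow> \<bar>s n x\<bar> \<le> w x"
    using bound unfolding eventually_sequentially by blast
  show ?thesis
  proof (rule LIMSEQ_offset, rule integral_dominated_convergence)
    show "AE x in M. norm (s (n + k) x) \<le> w x" for n
      using k[of "n + k"] by simp
    show "AE x in M. (\<lambda>n. s (n + k) x) \<longlonglongrightarrow> f x"
      using LIMSEQ_ignore_initial_segment[OF lim] by simp
  qed (use assms in auto)
qed

text \<open>
  With \<open>r n m\<close> the ratio of \<open>V n\<close> at \<open>c n + m\<close> and \<open>c n\<close>, the quotient is the expectation of
  \<open>f as * (\<Sum>j. h j * r n (j - sum as))\<close>. Dominated convergence is used for the sum over \<open>j\<close>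
  first; the bound \<open>I * exp (e * sum as)\<close> obtained along the way dominates the expectation over \<open>as\<close>.
\<close>
lemma mixture_limit:
  fixes P :: "nat list pmf" and V :: "nat \<Rightarrow> int pmf" and c :: "nat \<Rightarrow> int"
    and h :: "int \<Rightarrow> real" and f :: "nat list \<Rightarrow> real"
  assumes "0 < e"
    and bound: "\<forall>\<^sub>F n in sequentially. \<forall>m.
      pmf (V n) (c n + m) \<le> exp (e * \<bar>real_of_int m\<bar>) * pmf (V n) (c n)"
    and pos: "\<forall>\<^sub>F n in sequentially. 0 < pmf (V n) (c n)"
    and lim: "\<And>m. (\<lambda>n. pmf (V n) (c n + m) / pmf (V n) (c n)) \<longlonglongrightarrow> 1"
    and h0: "\<And>j. 0 \<le> h j"
    and h: "integrable (count_space UNIV) (\<lambda>j. h j * exp (e * \<bar>real_of_int j\<bar>))"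
    and P: "integrable P (\<lambda>as. exp (e * real (sum_list as)))"
    and f: "\<And>as. \<bar>f as\<bar> \<le> B"
  shows "(\<lambda>n. measure_pmf.expectation P (\<lambda>as. f as *
           measure_pmf.expectation (V n) (\<lambda>x. h (x + int (sum_list as) - c n))) / pmf (V n) (c n))
         \<longlonglongrightarrow> (\<integral>j. h j \<partial>count_space UNIV) * measure_pmf.expectation P f"
proof -
  define r where "r n m = pmf (V n) (c n + m) / pmf (V n) (c n)" for n m
  define I where "I = (\<integral>j. h j * exp (e * \<bar>real_of_int j\<bar>) \<partial>count_space UNIV)"
  define g where "g n s = (\<integral>j. h j * r n (j - int s) \<partial>count_space UNIV)" for n and s :: nat
  have r0: "0 \<le> r n m" for n m
    by (simp add: r_def)
  have B0: "0 \<le> B" using f[of undefined] by linarith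
  have g_eq: "measure_pmf.expectation (V n) (\<lambda>x. h (x + int s - c n)) / pmf (V n) (c n) = g n s" for n s
  proof -
    have "measure_pmf.expectation (V n) (\<lambda>x. h (x + int s - c n))
        = (\<integral>j. pmf (V n) (j - (int s - c n)) * h j \<partial>count_space UNIV)"
      using expectation_shift_int[of "V n" h "int s - c n"] by (simp add: algebra_simps)
    then show ?thesis
      by (simp add: g_def r_def algebra_simps flip: integral_divide_zero)
  qed
  have rbound: "\<forall>\<^sub>F n in sequentially. \<forall>s j. h j * r n (j - int s) \<le>
      exp (e * real s) * (h j * exp (e * \<bar>real_of_int j\<bar>))"
    using bound pos
  proof eventually_elim
    case (elim n)
    show ?case
    proof (intro allI)
      fix s j
      have "r n (j - int s) \<le> exp (e * \<bar>real_of_int (j - int s)\<bar>)"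
        using elim(1)[rule_format, of "j - int s"] elim(2) by (simp add: r_def divide_simps)
      also have "\<dots> \<le> exp (e * (\<bar>real_of_int j\<bar> + real s))"
        using \<open>0 < e\<close> by simp
      also have "\<dots> = exp (e * real s) * exp (e * \<bar>real_of_int j\<bar>)"
        by (simp add: exp_add[symmetric] algebra_simps)
      finally have "h j * r n (j - int s) \<le> h j * (exp (e * real s) * exp (e * \<bar>real_of_int j\<bar>))"
        by (intro mult_left_mono h0)
      then show "h j * r n (j - int s) \<le> exp (e * real s) * (h j * exp (e * \<bar>real_of_int j\<bar>))"
        by (simp add: mult_ac)
    qed
  qed
  have g_lim: "(\<lambda>n. g n s) \<longlonglongrightarrow> (\<integral>j. h j \<partial>count_space UNIV)" for s
    unfolding g_def
  proof (rule integral_tendsto_eventually_dominated)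
    show "integrable (count_space UNIV) (\<lambda>j. exp (e * real s) * (h j * exp (e * \<bar>real_of_int j\<bar>)))"
      by (intro integrable_mult_right h)
    show "(\<lambda>n. h j * r n (j - int s)) \<longlonglongrightarrow> h j" for j
      using tendsto_mult[OF tendsto_const lim[of "j - int s"], of "h j"] by (simp add: r_def)
    show "\<forall>\<^sub>F n in sequentially. \<forall>j. \<bar>h j * r n (j - int s)\<bar> \<le>
        exp (e * real s) * (h j * exp (e * \<bar>real_of_int j\<bar>))"
      using rbound by eventually_elim (simp add: h0 r0)
  qed auto
  have g_bound: "\<forall>\<^sub>F n in sequentially. \<forall>s. \<bar>g n s\<bar> \<le> I * exp (e * real s)"
    using rbound
  proof eventually_elim
    case (elim n)
    show ?case
    proof
      fix s
      have "g n s \<le> (\<integral>j. exp (e * real s) * (h j * exp (e * \<bar>real_of_int j\<bar>)) \<partial>count_space UNIV)"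
        unfolding g_def using elim
        by (intro integral_mono' integrable_mult_right h) (auto simp: h0 r0)
      moreover have "0 \<le> g n s"
        unfolding g_def by (simp add: h0 r0)
      ultimately show "\<bar>g n s\<bar> \<le> I * exp (e * real s)"
        by (simp add: I_def mult.commute)
    qed
  qed
  have "(\<lambda>n. measure_pmf.expectation P (\<lambda>as. f as * g n (sum_list as)))
      \<longlonglongrightarrow> measure_pmf.expectation P (\<lambda>as. f as * (\<integral>j. h j \<partial>count_space UNIV))"
  proof (rule integral_tendsto_eventually_dominated)
    show "integrable P (\<lambda>as. B * (I * exp (e * real (sum_list as))))"
      by (intro integrable_mult_right P)
    show "(\<lambda>n. f as * g n (sum_list as)) \<longlonglongrightarrow> f as * (\<integral>j. h j \<partial>count_space UNIV)" for as
      by (intro tendsto_mult tendsto_const g_lim)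
    show "\<forall>\<^sub>F n in sequentially. \<forall>as. \<bar>f as * g n (sum_list as)\<bar> \<le> B * (I * exp (e * real (sum_list as)))"
      using g_bound by eventually_elim (auto simp: abs_mult intro!: mult_mono f B0)
  qed auto
  moreover have "measure_pmf.expectation P (\<lambda>as. f as *
      measure_pmf.expectation (V n) (\<lambda>x. h (x + int (sum_list as) - c n))) / pmf (V n) (c n)
    = measure_pmf.expectation P (\<lambda>as. f as * g n (sum_list as))" for n
    by (simp only: g_eq[symmetric] times_divide_eq_right integral_divide_zero)
  ultimately show ?thesis
    by (simp add: mult.commute)
qed

text \<open>
  Only the first \<open>l\<close> entries and the sum of the remaining ones enter the integrand, and these are
  independent.
\<close>
lemma expectation_prefix_sum:
  fixes f :: "nat list \<Rightarrow> real" and h :: "int \<Rightarrow> real"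
  assumes "\<And>as. \<bar>f as\<bar> \<le> B" "\<And>j. \<bar>h j\<bar> \<le> C"
  shows "measure_pmf.expectation (list_law (l + m) \<nu>) (\<lambda>xs. f (take l xs) * h (int (sum_list xs) - c))
    = measure_pmf.expectation (list_law l \<nu>) (\<lambda>as. f as *
        measure_pmf.expectation (sum_law m (\<lambda>i. \<nu> (l + i))) (\<lambda>x. h (x + int (sum_list as) - c)))"
proof -
  have "\<bar>f as * h j\<bar> \<le> B * C" for as j
    unfolding abs_mult using assms(1)[of as] assms(2)[of j] by (intro mult_mono) auto
  then have "measure_pmf.expectation (list_law (l + m) \<nu>) (\<lambda>xs. f (take l xs) * h (int (sum_list xs) - c))
    = measure_pmf.expectation (list_law l \<nu>) (\<lambda>as.
        measure_pmf.expectation (list_law m (\<lambda>i. \<nu> (l + i)))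
          (\<lambda>bs. f (take l (as @ bs)) * h (int (sum_list (as @ bs)) - c)))"
    unfolding list_law_append by (subst expectation_bind_pmf[where B = "B * C"]) auto
  also have "\<dots> = measure_pmf.expectation (list_law l \<nu>) (\<lambda>as. f as *
        measure_pmf.expectation (sum_law m (\<lambda>i. \<nu> (l + i))) (\<lambda>x. h (x + int (sum_list as) - c)))"
  proof (rule integral_cong_AE)
    show "AE as in list_law l \<nu>.
        measure_pmf.expectation (list_law m (\<lambda>i. \<nu> (l + i)))
          (\<lambda>bs. f (take l (as @ bs)) * h (int (sum_list (as @ bs)) - c))
      = f as * measure_pmf.expectation (sum_law m (\<lambda>i. \<nu> (l + i))) (\<lambda>x. h (x + int (sum_list as) - c))"
      unfolding AE_measure_pmf_iff
      by (auto dest!: length_list_law simp: sum_law_def add.commute)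
  qed auto
  finally show ?thesis .
qed

lemma
  assumes "indep_with_laws M X \<nu>"
  shows measurable_map_upt: "(\<lambda>\<omega>. map (\<lambda>i. X i \<omega>) [0..<n]) \<in> measurable M (count_space UNIV)"
    and fdd_law_eq_list_law: "fdd_law M X n = measure_pmf (list_law n \<nu>)"
proof -
  interpret prob_space M using assms by (simp add: indep_with_laws_def)
  have indep: "indep_vars (\<lambda>_. count_space UNIV) X UNIV"
    and distr: "distr M (count_space UNIV) (X i) = measure_pmf (\<nu> i)" for i
    using assms by (auto simp: indep_with_laws_def)
  have X: "X i \<in> measurable M (count_space UNIV)" for i
    using indep by (auto simp: indep_vars_def)
  have marginal: "prob (X i -` {x} \<inter> space M) = pmf (\<nu> i) x" for i x
    using measure_distr[OF X, of "{x}" i] by (simp add: distr measure_pmf_single)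
  have vimage: "(\<lambda>\<omega>. map (\<lambda>i. X i \<omega>) [0..<n]) -` {xs} \<inter> space M
      = (if length xs = n then {\<omega> \<in> space M. \<forall>i<n. X i \<omega> = xs ! i} else {})" for xs
  proof -
    have "map (\<lambda>i. X i \<omega>) [0..<n] = xs \<longleftrightarrow> length xs = n \<and> (\<forall>i<n. X i \<omega> = xs ! i)" for \<omega>
      unfolding list_eq_iff_nth_eq length_map length_upt by force
    then show ?thesis
      unfolding vimage_def by force
  qed
  have sets: "{\<omega> \<in> space M. \<forall>i<n. X i \<omega> = xs ! i} \<in> sets M" for xs
  proof -
    have "{\<omega> \<in> space M. \<forall>i<n. X i \<omega> = xs ! i} = space M \<inter> (\<Inter>i\<in>{..<n}. X i -` {xs ! i} \<inter> space M)"
      by auto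
    moreover have "(\<Inter>i\<in>{..<n}. X i -` {xs ! i} \<inter> space M) \<in> sets M" if "n \<noteq> 0"
      by (rule sets.finite_INT) (use that measurable_sets[OF X] in auto)
    ultimately show ?thesis
      by (cases "n = 0") auto
  qed
  show meas: "(\<lambda>\<omega>. map (\<lambda>i. X i \<omega>) [0..<n]) \<in> measurable M (count_space UNIV)"
    unfolding measurable_count_space_eq2_countable
  proof (intro conjI ballI)
    fix xs :: "nat list"
    show "(\<lambda>\<omega>. map (\<lambda>i. X i \<omega>) [0..<n]) -` {xs} \<inter> space M \<in> sets M"
      by (cases "length xs = n") (simp_all only: vimage if_True if_False simp_thms sets sets.empty_sets)
  qed simp
  have prob: "prob {\<omega> \<in> space M. \<forall>i<n. X i \<omega> = xs ! i} = (\<Prod>i<n. pmf (\<nu> i) (xs ! i))" for xs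
  proof (cases "n = 0")
    case False
    then have "{\<omega> \<in> space M. \<forall>i<n. X i \<omega> = xs ! i} = (\<Inter>i\<in>{..<n}. X i -` {xs ! i} \<inter> space M)"
      by auto
    then show ?thesis
      using indep_varsD[OF indep, of "{..<n}" "\<lambda>i. {xs ! i}"] False by (auto simp: marginal lessThan_empty_iff)
  qed (simp add: prob_space)
  show "fdd_law M X n = measure_pmf (list_law n \<nu>)"
    unfolding fdd_law_def
  proof (rule measure_eqI_countable[where A = UNIV])
    fix xs :: "nat list"
    show "emeasure (distr M (count_space UNIV) (\<lambda>\<omega>. map (\<lambda>i. X i \<omega>) [0..<n])) {xs}
        = emeasure (measure_pmf (list_law n \<nu>)) {xs}"
      unfolding emeasure_distr[OF meas, of "{xs}", simplified sets_count_space Pow_UNIV, OF UNIV_I]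
      by (cases "length xs = n")
        (simp_all only: vimage if_True if_False simp_thms emeasure_eq_measure prob emeasure_pmf_single pmf_list_law
          measure_empty)
  qed auto
qed

text \<open>
  Transfers the conditioning from the abstract probability space to the law of the first \<open>n\<close>
  coordinates, on which the tilting formula can be used.
\<close>
lemma integral_fdd_law_uniform_measure:
  fixes f :: "nat list \<Rightarrow> real"
  assumes X: "indep_with_laws M X \<nu>" and "l \<le> n"
    and E: "\<And>\<omega>. E \<omega> \<longleftrightarrow> int (partial_sum X n \<omega>) - c \<in> A"
    and pos: "0 < measure_pmf.expectation (list_law n \<nu>) (\<lambda>xs. indicator A (int (sum_list xs) - c) :: real)"
  shows "(\<integral>as. f as \<partial>fdd_law (uniform_measure M {\<omega> \<in> space M. E \<omega>}) X l)
    = measure_pmf.expectation (list_law n \<nu>) (\<lambda>xs. f (take l xs) * indicator A (int (sum_list xs) - c))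
      / measure_pmf.expectation (list_law n \<nu>) (\<lambda>xs. indicator A (int (sum_list xs) - c))"
proof -
  interpret prob_space M using X by (simp add: indep_with_laws_def)
  define F where "F \<omega> = map (\<lambda>i. X i \<omega>) [0..<n]" for \<omega>
  define S where "S = {\<omega> \<in> space M. E \<omega>}"
  note meas = measurable_map_upt[OF X]
  have F[measurable]: "F \<in> measurable M (count_space UNIV)"
    unfolding F_def[abs_def] by (rule meas)
  have take: "take l (F \<omega>) = map (\<lambda>i. X i \<omega>) [0..<l]" for \<omega>
    using \<open>l \<le> n\<close> by (simp add: F_def take_map)
  have sum: "int (partial_sum X n \<omega>) = int (sum_list (F \<omega>))" for \<omega>
    by (simp add: partial_sum_def F_def interv_sum_list_conv_sum_set_nat atLeast0LessThan)
  have law: "measure_pmf.expectation (list_law n \<nu>) g = (\<integral>\<omega>. g (F \<omega>) \<partial>M)" for g :: "nat list \<Rightarrow> real"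
    unfolding fdd_law_eq_list_law[OF X, symmetric] fdd_law_def
    by (subst integral_distr[OF meas]) (auto simp: F_def)
  have ind: "indicator A (int (sum_list (F \<omega>)) - c) = (indicator S \<omega> :: real)" if "\<omega> \<in> space M" for \<omega>
    using that by (simp add: S_def E sum indicator_def)
  have S[measurable]: "S \<in> sets M"
  proof -
    have "S = F -` {xs. int (sum_list xs) - c \<in> A} \<inter> space M"
      by (auto simp: S_def E sum)
    then show ?thesis
      using measurable_sets[OF F] by simp
  qed
  have prob: "measure_pmf.expectation (list_law n \<nu>) (\<lambda>xs. indicator A (int (sum_list xs) - c)) = prob S"
  proof -
    have "(\<integral>\<omega>. indicator A (int (sum_list (F \<omega>)) - c) \<partial>M) = (\<integral>\<omega>. (indicator S \<omega> :: real) \<partial>M)"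
      by (intro Bochner_Integration.integral_cong refl ind)
    then show ?thesis by (simp add: law)
  qed
  have dens: "uniform_measure M S = density M (\<lambda>\<omega>. ennreal (indicator S \<omega> / prob S))"
    unfolding uniform_measure_def
  proof (rule arg_cong[where f = "density M"], rule ext)
    fix \<omega>
    show "indicator S \<omega> / emeasure M S = ennreal (indicator S \<omega> / prob S)"
      using pos divide_ennreal[of "indicator S \<omega>" "prob S"] unfolding prob
      by (simp add: emeasure_eq_measure ennreal_indicator)
  qed
  have "(\<integral>as. f as \<partial>fdd_law (uniform_measure M S) X l) = (\<integral>\<omega>. f (take l (F \<omega>)) \<partial>uniform_measure M S)"
    unfolding fdd_law_def take
    by (rule integral_distr) (use meas[of l] in \<open>auto cong: measurable_cong_sets\<close>)
  also have "\<dots> = (\<integral>\<omega>. f (take l (F \<omega>)) * indicator S \<omega> / prob S \<partial>M)"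
    unfolding dens by (subst integral_density) (auto simp: mult.commute)
  also have "\<dots> = (\<integral>\<omega>. f (take l (F \<omega>)) * indicator A (int (sum_list (F \<omega>)) - c) \<partial>M) / prob S"
    unfolding integral_divide_zero
    by (intro arg_cong2[where f = "(/)"] Bochner_Integration.integral_cong refl) (simp add: ind)
  finally show ?thesis
    by (simp add: prob law S_def)
qed

section \<open>The limit theorem\<close>

text \<open>
  The moment equals \<open>exp (M\<^sub>n (t + s) - M\<^sub>n t - s * R n)\<close> up to the factor of the first \<open>l\<close> coordinates,
  which is fixed, and \<open>exp (s * (R n - c n))\<close>, which stays between \<open>exp (- \<bar>s\<bar>)\<close> and \<open>exp \<bar>s\<bar>\<close>.
\<close>
lemma filterlim_moments_shifted:
  fixes \<nu> :: "nat \<Rightarrow> nat pmf" and c :: "nat \<Rightarrow> int" and R :: "nat \<Rightarrow> real"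
  assumes fin: "\<And>i. part_fun (\<nu> i) (exp t) < \<infinity>" "\<And>i. part_fun (\<nu> i) (exp (t + s)) < \<infinity>"
    and c: "\<And>n. \<bar>real_of_int (c n) - R n\<bar> \<le> 1"
    and lim: "filterlim (\<lambda>n. log_mgf_sum \<nu> n (t + s) - log_mgf_sum \<nu> n t - s * R n) at_top sequentially"
  shows "filterlim (\<lambda>n. measure_pmf.expectation (sum_law (n - l) (\<lambda>i. tilted (\<nu> (l + i)) (exp t)))
           (\<lambda>x. exp (s * real_of_int (x - c n)))) at_top sequentially"
proof -
  define K where "K = \<bar>s\<bar> + (log_mgf_sum \<nu> l (t + s) - log_mgf_sum \<nu> l t)"
  have eq: "measure_pmf.expectation (sum_law (n - l) (\<lambda>i. tilted (\<nu> (l + i)) (exp t)))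
        (\<lambda>x. exp (s * real_of_int (x - c n)))
      = exp (log_mgf_sum \<nu> n (t + s) - log_mgf_sum \<nu> n t - s * R n + s * (R n - real_of_int (c n))
          - (log_mgf_sum \<nu> l (t + s) - log_mgf_sum \<nu> l t))" if "l \<le> n" for n
  proof -
    have "measure_pmf.expectation (sum_law (n - l) (\<lambda>i. tilted (\<nu> (l + i)) (exp t)))
        (\<lambda>x. exp (s * real_of_int (x - c n)))
      = measure_pmf.expectation (list_law (n - l) (\<lambda>i. tilted (\<nu> (l + i)) (exp t)))
          (\<lambda>xs. exp (- s * real_of_int (c n)) * exp (s * real (sum_list xs)))"
      by (simp add: sum_law_def exp_add[symmetric] algebra_simps)
    also have "\<dots> = exp (- s * real_of_int (c n)) *
        exp (log_mgf_sum (\<lambda>i. \<nu> (l + i)) (n - l) (t + s) - log_mgf_sum (\<lambda>i. \<nu> (l + i)) (n - l) t)"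
      unfolding integral_mult_right_zero
      using expectation_exp_sum_tilted[where \<nu> = "\<lambda>i. \<nu> (l + i)", OF fin] by simp
    moreover have "log_mgf_sum (\<lambda>i. \<nu> (l + i)) (n - l) u = log_mgf_sum \<nu> n u - log_mgf_sum \<nu> l u" for u
      using log_mgf_sum_shift[of \<nu> l "n - l" u] that by simp
    ultimately show ?thesis
      by (simp add: exp_add[symmetric] right_diff_distrib)
  qed
  have "filterlim (\<lambda>n. - K + (log_mgf_sum \<nu> n (t + s) - log_mgf_sum \<nu> n t - s * R n)) at_top sequentially"
    by (intro filterlim_tendsto_add_at_top[OF tendsto_const] lim)
  then have "filterlim (\<lambda>n. exp (- K + (log_mgf_sum \<nu> n (t + s) - log_mgf_sum \<nu> n t - s * R n))) at_top sequentially"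
    by (rule filterlim_compose[OF exp_at_top])
  then show ?thesis
  proof (rule filterlim_at_top_mono)
    show "\<forall>\<^sub>F n in sequentially. exp (- K + (log_mgf_sum \<nu> n (t + s) - log_mgf_sum \<nu> n t - s * R n))
      \<le> measure_pmf.expectation (sum_law (n - l) (\<lambda>i. tilted (\<nu> (l + i)) (exp t)))
           (\<lambda>x. exp (s * real_of_int (x - c n)))"
      using eventually_ge_at_top[of l]
    proof eventually_elim
      case (elim n)
      have "\<bar>s * (R n - real_of_int (c n))\<bar> \<le> \<bar>s\<bar> * 1"
        unfolding abs_mult using c[of n] by (intro mult_left_mono) auto
      then show ?case
        unfolding eq[OF elim] by (simp add: K_def)
    qed
  qed
qed

text \<open>
  This covers all three events at once. The condition \<open>0 \<le> t * j\<close> on \<open>A\<close> keeps the weight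
  \<open>h j = exp (- t * j)\<close> bounded on \<open>A\<close>, as the splitting formula \<open>expectation_prefix_sum\<close> requires, and
  integrability with the extra factor \<open>exp (e * \<bar>j\<bar>)\<close> leaves room for the growth bound on \<open>V\<close>.
\<close>
lemma conditional_limit:
  fixes \<nu> :: "nat \<Rightarrow> nat pmf" and c :: "nat \<Rightarrow> int" and A :: "int set"
  assumes lc: "\<And>i. log_concave_pmf (\<nu> i)"
    and X: "indep_with_laws M X \<nu>"
    and Y: "indep_with_laws N Y (\<lambda>i. tilted (\<nu> i) (exp t))"
    and d: "0 < d" and fin: "\<And>i u. u < t + d \<Longrightarrow> part_fun (\<nu> i) (exp u) < \<infinity>"
    and lim: "\<And>s. s \<noteq> 0 \<Longrightarrow> \<bar>s\<bar> < d \<Longrightarrow>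
      filterlim (\<lambda>n. log_mgf_sum \<nu> n (t + s) - log_mgf_sum \<nu> n t - s * R n) at_top sequentially"
    and c: "\<And>n. \<bar>real_of_int (c n) - R n\<bar> \<le> 1"
    and A: "0 \<in> A" "\<And>j. j \<in> A \<Longrightarrow> 0 \<le> t * real_of_int j" "0 < e"
      "integrable (count_space UNIV) (\<lambda>j. indicator A j * exp (- t * real_of_int j) * exp (e * \<bar>real_of_int j\<bar>))"
    and E: "\<And>n \<omega>. E n \<omega> \<longleftrightarrow> int (partial_sum X n \<omega>) - c n \<in> A"
  shows "cond_fdd_conv M X E N Y"
  unfolding cond_fdd_conv_def weak_conv_discrete_def
proof (intro allI impI)
  fix l :: nat and f :: "nat list \<Rightarrow> real"
  assume "bounded (range f)"
  then obtain B where B: "\<bar>f as\<bar> \<le> B" for as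
    by (auto simp: bounded_iff)
  define q where "q i = tilted (\<nu> i) (exp t)" for i
  define V where "V n = sum_law (n - l) (\<lambda>i. q (l + i))" for n
  define P where "P = list_law l q"
  define h where "h j = indicator A j * exp (- t * real_of_int j)" for j
  define I where "I g n = measure_pmf.expectation P (\<lambda>as. g as *
      measure_pmf.expectation (V n) (\<lambda>x. h (x + int (sum_list as) - c n)))" for g n
  have fin_t: "part_fun (\<nu> i) (exp t) < \<infinity>" for i
    using fin[of t] d by simp
  have h0: "0 \<le> h j" and h1: "\<bar>h j\<bar> \<le> 1" for j
    using A(2)[of j] by (auto simp: h_def indicator_def)

  have V: "log_concave_seq (pmf (V n))" for n
    unfolding V_def q_def
    by (intro log_concave_seq_sum_law log_concave_seq_tilted log_concave_pmf_imp_log_concave_seq lc fin_t)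
  have moments: "filterlim (\<lambda>n. measure_pmf.expectation (V n) (\<lambda>x. exp (s * real_of_int (x - c n))))
      at_top sequentially" if "s \<noteq> 0" "\<bar>s\<bar> < d" for s
    unfolding V_def q_def
    by (rule filterlim_moments_shifted[OF fin_t _ c lim[OF that]]) (use fin[of "t + s"] that in auto)
  note slow = slow_variation_limit[OF V d moments moments, simplified]

  \<comment> \<open>Small enough for the weight \<open>h\<close> and for the tilted moments at \<open>t + e'\<close>.\<close>
  define e' where "e' = min e (d / 2)"
  have e': "0 < e'" "e' \<le> e" "e' < d"
    using \<open>0 < e\<close> d by (auto simp: e'_def)
  have h_int: "integrable (count_space UNIV) (\<lambda>j. h j * exp (e' * \<bar>real_of_int j\<bar>))"
    by (rule Bochner_Integration.integrable_bound[OF A(4)])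
      (use e' in \<open>auto simp: h_def indicator_def intro!: mult_right_mono\<close>)
  have P_int: "integrable P (\<lambda>as. exp (e' * real (sum_list as)))"
    unfolding P_def q_def by (intro integrable_exp_sum_tilted fin_t fin) (use e' in auto)
  define C where "C = (\<integral>j. h j \<partial>count_space UNIV)"
  \<comment> \<open>The atom at \<open>0 \<in> A\<close> has weight 1.\<close>
  have "1 \<le> C"
  proof -
    have "h j \<le> h j * exp (e' * \<bar>real_of_int j\<bar>)" for j
      using mult_left_mono[OF _ h0, of 1 "exp (e' * \<bar>real_of_int j\<bar>)" j] e' by simp
    then have "integrable (count_space UNIV) h"
      by (intro Bochner_Integration.integrable_bound[OF h_int]) (auto simp: h0 abs_mult)
    then have "(\<integral>j. indicator {0::int} j \<partial>count_space UNIV) \<le> C"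
      unfolding C_def by (rule integral_mono') (use A(1) h0 in \<open>auto simp: h_def indicator_def\<close>)
    then show ?thesis
      by simp
  qed
  have mix: "(\<lambda>n. I g n / pmf (V n) (c n)) \<longlonglongrightarrow> C * measure_pmf.expectation P g"
    if "\<And>as. \<bar>g as\<bar> \<le> K" for g K
    unfolding I_def C_def
    by (rule mixture_limit[OF e'(1) slow(2)[OF e'(1)] slow(1) slow(3) h0 h_int P_int that])
  have lim_f: "(\<lambda>n. I f n / pmf (V n) (c n)) \<longlonglongrightarrow> C * measure_pmf.expectation P f"
    by (rule mix[OF B])
  have lim_1: "(\<lambda>n. I (\<lambda>_. 1) n / pmf (V n) (c n)) \<longlonglongrightarrow> C"
    using mix[of "\<lambda>_. 1" 1] by simp

  \<comment> \<open>Both numerator (\<open>g = f\<close>) and denominator (\<open>g = 1\<close>) carry the same factor, which cancels.\<close>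
  have change: "measure_pmf.expectation (list_law n \<nu>) (\<lambda>xs. g (take l xs) * indicator A (int (sum_list xs) - c n))
      = exp (- t * real_of_int (c n)) * exp (log_mgf_sum \<nu> n t) * I g n"
    if "l \<le> n" "\<And>as. \<bar>g as\<bar> \<le> K" for g n K
  proof -
    have "measure_pmf.expectation (list_law n \<nu>) (\<lambda>xs. g (take l xs) * indicator A (int (sum_list xs) - c n))
      = measure_pmf.expectation (list_law n \<nu>) (\<lambda>xs. exp (- t * real_of_int (c n)) *
          (exp (t * real (sum_list xs)) * (g (take l xs) * h (int (sum_list xs) - c n))))"
    proof (intro Bochner_Integration.integral_cong refl)
      fix xs
      have "exp (- t * real_of_int (c n)) * (exp (t * real (sum_list xs)) * exp (- t * (real (sum_list xs) - real_of_int (c n)))) = 1"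
        by (simp add: exp_add[symmetric] algebra_simps)
      then show "g (take l xs) * indicator A (int (sum_list xs) - c n) = exp (- t * real_of_int (c n)) *
          (exp (t * real (sum_list xs)) * (g (take l xs) * h (int (sum_list xs) - c n)))"
        by (simp add: h_def indicator_def)
    qed
    also have "\<dots> = exp (- t * real_of_int (c n)) * (exp (log_mgf_sum \<nu> n t) *
        measure_pmf.expectation (list_law (l + (n - l)) q) (\<lambda>xs. g (take l xs) * h (int (sum_list xs) - c n)))"
      using that(1) unfolding q_def by (simp add: expectation_list_law_tilt[OF fin_t])
    also have "measure_pmf.expectation (list_law (l + (n - l)) q) (\<lambda>xs. g (take l xs) * h (int (sum_list xs) - c n)) = I g n"
      unfolding I_def P_def V_def by (rule expectation_prefix_sum[OF that(2) h1])
    finally show ?thesis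
      by simp
  qed
  have "\<forall>\<^sub>F n in sequentially. 0 < I (\<lambda>_. 1) n / pmf (V n) (c n)"
    using order_tendstoD(1)[OF lim_1, of 0] \<open>1 \<le> C\<close> by simp
  then have ev: "\<forall>\<^sub>F n in sequentially. (\<integral>as. f as \<partial>fdd_law (uniform_measure M {\<omega> \<in> space M. E n \<omega>}) X l)
      = (I f n / pmf (V n) (c n)) / (I (\<lambda>_. 1) n / pmf (V n) (c n))"
    using slow(1) eventually_ge_at_top[of l]
  proof eventually_elim
    case (elim n)
    have den: "measure_pmf.expectation (list_law n \<nu>) (\<lambda>xs. indicator A (int (sum_list xs) - c n))
        = exp (- t * real_of_int (c n)) * exp (log_mgf_sum \<nu> n t) * I (\<lambda>_. 1) n"
      using change[OF elim(3), of "\<lambda>_. 1" 1] by simp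
    have "0 < I (\<lambda>_. 1) n"
      using elim(1,2) by (simp add: zero_less_divide_iff)
    then have "0 < measure_pmf.expectation (list_law n \<nu>) (\<lambda>xs. indicator A (int (sum_list xs) - c n) :: real)"
      unfolding den by simp
    from integral_fdd_law_uniform_measure[OF X elim(3) E this, of f]
    show ?case
      unfolding den change[where g = f, OF elim(3) B] using elim(2) by simp
  qed
  have "(\<lambda>n. (I f n / pmf (V n) (c n)) / (I (\<lambda>_. 1) n / pmf (V n) (c n))) \<longlonglongrightarrow>
      (C * measure_pmf.expectation P f) / C"
    using \<open>1 \<le> C\<close> by (intro tendsto_divide lim_f lim_1) auto
  then have "(\<lambda>n. \<integral>as. f as \<partial>fdd_law (uniform_measure M {\<omega> \<in> space M. E n \<omega>}) X l)
      \<longlonglongrightarrow> measure_pmf.expectation P f"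
    using \<open>1 \<le> C\<close> by (simp add: tendsto_cong[OF ev])
  then show "(\<lambda>n. \<integral>as. f as \<partial>fdd_law (uniform_measure M {\<omega> \<in> space M. E n \<omega>}) X l)
      \<longlonglongrightarrow> (\<integral>as. f as \<partial>fdd_law N Y l)"
    by (simp add: fdd_law_eq_list_law[OF Y] P_def q_def[abs_def])
qed

lemma expectation_partial_sum_eq_deriv:
  assumes Y: "indep_with_laws N Y (\<lambda>i. tilted (\<nu> i) (exp t))"
    and "t < u" "\<And>i. part_fun (\<nu> i) (exp u) < \<infinity>"
  shows "(\<integral>\<omega>. real (partial_sum Y n \<omega>) \<partial>N) = deriv (log_mgf_sum \<nu> n) t"
proof -
  interpret prob_space N using Y by (simp add: indep_with_laws_def)
  have meas: "Y i \<in> measurable N (count_space UNIV)"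
    and distr: "distr N (count_space UNIV) (Y i) = measure_pmf (tilted (\<nu> i) (exp t))" for i
    using Y by (auto simp: indep_with_laws_def indep_vars_def)
  note der = log_part_fun_derivative[OF \<open>t < u\<close> assms(3)]
  have int: "integrable N (\<lambda>\<omega>. real (Y i \<omega>))" for i
    using der(1)[of i] integrable_distr_eq[OF meas[of i], of real] by (simp add: distr)
  have E: "(\<integral>\<omega>. real (Y i \<omega>) \<partial>N) = measure_pmf.expectation (tilted (\<nu> i) (exp t)) real" for i
    using integral_distr[OF meas[of i], of real] by (simp add: distr)
  have "(log_mgf_sum \<nu> n has_real_derivative (\<Sum>i<n. measure_pmf.expectation (tilted (\<nu> i) (exp t)) real)) (at t)"
    unfolding log_mgf_sum_def[abs_def] by (intro DERIV_sum der(2))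
  then have "deriv (log_mgf_sum \<nu> n) t = (\<Sum>i<n. measure_pmf.expectation (tilted (\<nu> i) (exp t)) real)"
    by (rule DERIV_imp_deriv)
  also have "\<dots> = (\<integral>\<omega>. real (partial_sum Y n \<omega>) \<partial>N)"
    by (simp add: partial_sum_def int E)
  finally show ?thesis by simp
qed


theorem theorem1:
  fixes \<nu> :: "nat \<Rightarrow> nat pmf"
    and M :: "'a measure" and X :: "nat \<Rightarrow> 'a \<Rightarrow> nat"
    and N :: "'b measure" and Y :: "nat \<Rightarrow> 'b \<Rightarrow> nat"
    and lam t :: real and R :: "nat \<Rightarrow> real"
  assumes "\<And>i. log_concave_pmf (\<nu> i)"
    and "indep_with_laws M X \<nu>"
    and "0 < lam" and "ereal lam < lambda_max \<nu>"
    and "indep_with_laws N Y (\<lambda>i. tilted (\<nu> i) lam)"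
    and "\<And>n. R n = (\<integral>\<omega>. real (partial_sum Y n \<omega>) \<partial>N)"
    and "t = ln lam"
    and "\<And>\<epsilon>. 0 < \<epsilon> \<Longrightarrow> ereal \<epsilon> < ereal_ln (lambda_max \<nu>) - ereal t \<Longrightarrow>
           filterlim (\<lambda>n. log_mgf_sum \<nu> n (t - \<epsilon>) - log_mgf_sum \<nu> n t
                          + \<epsilon> * deriv (log_mgf_sum \<nu> n) t) at_top sequentially"
    and "\<And>\<epsilon>. 0 < \<epsilon> \<Longrightarrow> ereal \<epsilon> < ereal_ln (lambda_max \<nu>) - ereal t \<Longrightarrow>
           filterlim (\<lambda>n. log_mgf_sum \<nu> n (t + \<epsilon>) - log_mgf_sum \<nu> n t
                          - \<epsilon> * deriv (log_mgf_sum \<nu> n) t) at_top sequentially"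
  shows "(1 < lam \<longrightarrow> cond_fdd_conv M X (\<lambda>n \<omega>. real (partial_sum X n \<omega>) > R n) N Y) \<and>
         (lam < 1 \<longrightarrow> cond_fdd_conv M X (\<lambda>n \<omega>. real (partial_sum X n \<omega>) < R n) N Y) \<and>
         cond_fdd_conv M X (\<lambda>n \<omega>. int (partial_sum X n \<omega>) = \<lfloor>R n\<rfloor>) N Y"
proof -
  have lam: "lam = exp t"
    using assms(3,7) by simp
  \<comment> \<open>Any point strictly between \<open>lam\<close> and \<open>lambda_max \<nu>\<close>; it yields room \<open>d\<close> for tilting above \<open>t\<close>.\<close>
  obtain mu where mu: "lam < mu" "ereal mu < lambda_max \<nu>"
    using ereal_dense2[OF assms(4)] by auto
  define d where "d = ln mu - t"
  have d: "0 < d"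
    using mu(1) assms(3,7) by (simp add: d_def)
  have mu_exp: "mu = exp (t + d)"
    using mu(1) assms(3) by (simp add: d_def)
  have fin: "part_fun (\<nu> i) (exp u) < \<infinity>" if "u < t + d" for i u
    using that mu(2) order_less_trans[of "ereal (exp u)" "ereal mu" "lambda_max \<nu>"]
    by (intro part_fun_finite) (auto simp: mu_exp)
  have room: "ereal e < ereal_ln (lambda_max \<nu>) - ereal t" if "e < d" for e
  proof (cases "lambda_max \<nu>")
    case (real r)
    then have "t + d < ln r"
      using mu(2) by (metis exp_gt_zero ereal_less(2) ereal_less_eq less_ereal.simps(1) ln_exp ln_less_cancel_iff mu_exp order_less_trans)
    moreover have "0 < r"
      using mu assms(3) real by simp
    ultimately show ?thesis
      using that real by (simp add: ereal_ln_def)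
  qed (use mu(2) in \<open>auto simp: ereal_ln_def\<close>)
  have R: "R n = deriv (log_mgf_sum \<nu> n) t" for n
    unfolding assms(6)
    by (rule expectation_partial_sum_eq_deriv[of N Y \<nu> t "t + d / 2"])
      (use assms(5) d fin[of "t + d / 2"] in \<open>auto simp: lam\<close>)
  have lim: "filterlim (\<lambda>n. log_mgf_sum \<nu> n (t + s) - log_mgf_sum \<nu> n t - s * R n) at_top sequentially"
    if "s \<noteq> 0" "\<bar>s\<bar> < d" for s
  proof (cases "0 < s")
    case True
    then show ?thesis
      using assms(9)[of s] room[of s] that by (simp add: R)
  next
    case False
    then show ?thesis
      using assms(8)[of "- s"] room[of "- s"] that by (simp add: R)
  qed
  note limit = conditional_limit[OF assms(1,2) assms(5)[unfolded lam] d fin lim]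
  \<comment> \<open>The weight decays at rate \<open>\<bar>b\<bar>\<close> on its half line, so half of the rate can be given away.\<close>
  have half_line: "integrable (count_space UNIV) (\<lambda>j. indicator (range g) j * exp (- b * real_of_int j) *
      exp (\<bar>b\<bar> / 2 * \<bar>real_of_int j\<bar>))"
    if "inj g" and g: "\<And>m. b * real_of_int (g m) = \<bar>b\<bar> * real m" "\<And>m. \<bar>g m\<bar> = int m" and "b \<noteq> 0"
    for g :: "nat \<Rightarrow> int" and b
  proof -
    have "(\<lambda>j. indicator (range g) j * exp (- b * real_of_int j) * exp (\<bar>b\<bar> / 2 * \<bar>real_of_int j\<bar>))
        = (\<lambda>j. if j \<in> range g then exp (- (\<bar>b\<bar> / 2) * real (inv g j)) else 0)"
    proof
      fix j
      show "indicator (range g) j * exp (- b * real_of_int j) * exp (\<bar>b\<bar> / 2 * \<bar>real_of_int j\<bar>)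
          = (if j \<in> range g then exp (- (\<bar>b\<bar> / 2) * real (inv g j)) else 0)"
      proof (cases "j \<in> range g")
        case True
        then obtain m where m: "j = g m" by auto
        have "\<bar>real_of_int (g m)\<bar> = real m"
          using g(2)[of m] by linarith
        then show ?thesis
          using g(1)[of m] inv_f_f[OF \<open>inj g\<close>, of m] True
          by (simp add: m exp_add[symmetric] field_simps)
      qed simp
    qed
    then show ?thesis
      using exponential_on_range(1)[of "\<bar>b\<bar> / 2" g] that by simp
  qed
  show ?thesis
  proof (intro conjI impI)
    assume "1 < lam"
    then have t: "0 < t" by (simp add: lam)
    have range: "range int = {0..}"
      by (auto simp: image_iff) (metis zero_le_imp_eq_int)
    show "cond_fdd_conv M X (\<lambda>n \<omega>. real (partial_sum X n \<omega>) > R n) N Y"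
    proof (rule limit[where c = "\<lambda>n. \<lfloor>R n\<rfloor> + 1" and A = "{0..}" and e = "\<bar>t\<bar> / 2"])
      show "integrable (count_space UNIV) (\<lambda>j. indicator {0..} j * exp (- t * real_of_int j) *
          exp (\<bar>t\<bar> / 2 * \<bar>real_of_int j\<bar>))"
        using half_line[of int t] t unfolding range by simp
      show "\<bar>real_of_int (\<lfloor>R n\<rfloor> + 1) - R n\<bar> \<le> 1" for n
        by linarith
      show "real (partial_sum X n \<omega>) > R n \<longleftrightarrow> int (partial_sum X n \<omega>) - (\<lfloor>R n\<rfloor> + 1) \<in> {0..}" for n \<omega>
        unfolding atLeast_iff by linarith
    qed (use t in auto)
  next
    assume "lam < 1"
    then have t: "t < 0" by (simp add: lam)
    have range: "range (\<lambda>m. - int m) = {..0}"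
      by (auto simp: image_iff) (metis minus_minus neg_0_le_iff_le zero_le_imp_eq_int)
    show "cond_fdd_conv M X (\<lambda>n \<omega>. real (partial_sum X n \<omega>) < R n) N Y"
    proof (rule limit[where c = "\<lambda>n. \<lceil>R n\<rceil> - 1" and A = "{..0}" and e = "\<bar>t\<bar> / 2"])
      show "integrable (count_space UNIV) (\<lambda>j. indicator {..0} j * exp (- t * real_of_int j) *
          exp (\<bar>t\<bar> / 2 * \<bar>real_of_int j\<bar>))"
        using half_line[of "\<lambda>m. - int m" t] t unfolding range by (simp add: inj_def)
      show "\<bar>real_of_int (\<lceil>R n\<rceil> - 1) - R n\<bar> \<le> 1" for n
        by linarith
      show "real (partial_sum X n \<omega>) < R n \<longleftrightarrow> int (partial_sum X n \<omega>) - (\<lceil>R n\<rceil> - 1) \<in> {..0}" for n \<omega>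
        unfolding atMost_iff by linarith
      show "0 \<le> t * real_of_int j" if "j \<in> {..0}" for j
        using t that by (simp add: zero_le_mult_iff)
    qed (use t in auto)
  next
    show "cond_fdd_conv M X (\<lambda>n \<omega>. int (partial_sum X n \<omega>) = \<lfloor>R n\<rfloor>) N Y"
    proof (rule limit[where c = "\<lambda>n. \<lfloor>R n\<rfloor>" and A = "{0}" and e = 1])
      have "(\<lambda>j::int. indicator {0} j * exp (- t * real_of_int j) * exp (1 * \<bar>real_of_int j\<bar>))
          = (indicator {0} :: int \<Rightarrow> real)"
        by (auto simp: indicator_def)
      then show "integrable (count_space UNIV) (\<lambda>j::int. indicator {0} j * exp (- t * real_of_int j) *
          exp (1 * \<bar>real_of_int j\<bar>))"
        by (simp add: integrable_indicator_iff)
      show "\<bar>real_of_int \<lfloor>R n\<rfloor> - R n\<bar> \<le> 1" for n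
        by linarith
    qed auto
  qed
qed

end
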